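(* Let $\mathcal W_{\mathbf M}^{\psi}[f](b,a)$ and $\mathcal W_{\mathbf M}^{\psi}[g](b,a)$ be the special affine wavelet transforms of $f$ and $g$ belonging to $L^2(\mathbb R)$, respectively. Then $$\int_{\mathbb R}\int_{\mathbb R^+}\mathcal W_{\mathbf M}^{\psi}[f](b,a)\,\overline{\mathcal W_{\mathbf M}^{\psi}[g](b,a)}\,\frac{db\,da}{a^2}=C_\psi\,\langle f,g\rangle_{L^2(\mathbb R)},$$ where $C_\psi$ is given by the admissibility condition $$C_\psi=\int_{\mathbb R^+}\frac{1}{a}\left|\mathrm S_{\mathbf M}\left[\exp\left\{\frac{i}{2B}\left(2zp(a-1)-Az^2\right)\right\}\overline{\psi(-z)}\right](a\omega)\right|^2da<\infty\quad\text{a.e. }\omega\in\mathbb R.$$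
   Context: Fix real parameters $A,B,C,D,p,q$ with $AD-BC=1$ and $B\neq0$, and write $\mathbf M=(A,B,C,D:p,q)$; $\mathbb R^+=(0,\infty)$. The special affine Fourier transform (SAFT) is $\mathrm S_{\mathbf M}[f](\omega)=\int_{\mathbb R}f(t)\,\mathcal K_{\mathbf M}(t,\omega)\,dt$ with $$\mathcal K_{\mathbf M}(t,\omega)=\frac{1}{\sqrt{i2\pi B}}\exp\left\{\frac{i}{2B}\left(At^2+2t(p-\omega)-2\omega(Dp-Bq)+D(\omega^2+p^2)\right)\right\},$$ understood on $L^2(\mathbb R)$ in the usual Plancherel sense. In the formula for $C_\psi$ the SAFT is taken in the variable $z$ with $a$ fixed, and evaluated at $a\omega$. For a wavelet $\psi\in L^2(\mathbb R)$, $b\in\mathbb R$, $a\in\mathbb R^+$ put $$\psi^{\mathbf M}_{b,a}(t)=\frac{1}{\sqrt{i2\pi aB}}\,\psi\left(\frac{t-b}{a}\right)\exp\left\{-\frac{i}{2B}\left(At^2+Dp^2-A\left(\frac ba\right)^2\right)\right\}.$$ The special affine wavelet transform of $f\in L^2(\mathbb R)$ with respect to $\psi$ is $\mathcal W_{\mathbf M}^{\psi}[f](b,a)=\int_{\mathbb R}f(t)\,\overline{\psi^{\mathbf M}_{b,a}(t)}\,dt$. *)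

theory Defs
  imports "HOL-Analysis.Analysis"
begin

text \<open>Elements of \<open>L\<^sup>2(\<real>)\<close> are given by Borel measurable representatives.\<close>

definition L2 :: "(real \<Rightarrow> complex) set" where
  "L2 = {f \<in> borel_measurable lborel. integrable lborel (\<lambda>t. (norm (f t))\<^sup>2)}"

definition L2_inner :: "(real \<Rightarrow> complex) \<Rightarrow> (real \<Rightarrow> complex) \<Rightarrow> complex" where
  "L2_inner f g = (LINT t|lborel. f t * cnj (g t))"

text \<open>The parameters \<open>(A, B, C, D : p, q)\<close>. Complex square roots are principal branches.\<close>

type_synonym saft_params = "real \<times> real \<times> real \<times> real \<times> real \<times> real"

fun saft_kernel :: "saft_params \<Rightarrow> real \<Rightarrow> real \<Rightarrow> complex" where
  "saft_kernel (A, B, C, D, p, q) t \<omega> =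
     1 / csqrt (\<i> * of_real (2 * pi * B)) *
     exp (\<i> / of_real (2 * B) *
          of_real (A * t\<^sup>2 + 2 * t * (p - \<omega>) - 2 * \<omega> * (D * p - B * q) + D * (\<omega>\<^sup>2 + p\<^sup>2)))"

text \<open>
  The special affine Fourier transform on \<open>L\<^sup>2(\<real>)\<close> in the Plancherel sense: \<open>F\<close> is the limit in
  quadratic mean of the absolutely convergent transforms of the truncations of \<open>f\<close> to \<open>[-n, n]\<close>.
  This determines \<open>F\<close> only up to null sets, hence a relation rather than a function.
\<close>

definition is_saft :: "saft_params \<Rightarrow> (real \<Rightarrow> complex) \<Rightarrow> (real \<Rightarrow> complex) \<Rightarrow> bool" where
  "is_saft M f F \<longleftrightarrow> F \<in> L2 \<and>
     (\<lambda>n. \<integral>\<^sup>+\<omega>. ennreal ((norm (F \<omega> -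
            (LINT t:{- real n..real n}|lborel. f t * saft_kernel M t \<omega>)))\<^sup>2) \<partial>lborel)
       \<longlonglongrightarrow> 0"

fun sa_wavelet :: "saft_params \<Rightarrow> (real \<Rightarrow> complex) \<Rightarrow> real \<Rightarrow> real \<Rightarrow> real \<Rightarrow> complex" where
  "sa_wavelet (A, B, C, D, p, q) \<psi> b a t =
     1 / csqrt (\<i> * of_real (2 * pi * a * B)) * \<psi> ((t - b) / a) *
     exp (- (\<i> / of_real (2 * B)) * of_real (A * t\<^sup>2 + D * p\<^sup>2 - A * (b / a)\<^sup>2))"

definition sa_wavelet_transform ::
  "saft_params \<Rightarrow> (real \<Rightarrow> complex) \<Rightarrow> (real \<Rightarrow> complex) \<Rightarrow> real \<Rightarrow> real \<Rightarrow> complex" where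
  "sa_wavelet_transform M \<psi> f b a = (LINT t|lborel. f t * cnj (sa_wavelet M \<psi> b a t))"

fun admissibility_arg :: "saft_params \<Rightarrow> (real \<Rightarrow> complex) \<Rightarrow> real \<Rightarrow> real \<Rightarrow> complex" where
  "admissibility_arg (A, B, C, D, p, q) \<psi> a z =
     exp (\<i> / of_real (2 * B) * of_real (2 * z * p * (a - 1) - A * z\<^sup>2)) * cnj (\<psi> (- z))"

text \<open>
  The admissibility condition: for almost every \<open>\<omega>\<close> the integral is finite and its value is the
  constant \<open>K\<close>. For each \<open>a\<close> the transform \<open>\<Phi> a\<close> is determined only almost everywhere; for
  \<open>\<Phi> a (a * \<omega>)\<close> to be integrated over \<open>a\<close> the representatives have to be chosen jointly measurably
  in \<open>(a, \<omega>)\<close>. By Fubini, two such choices give the same integral for almost every \<open>\<omega>\<close>.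
\<close>

definition admissible_with ::
  "saft_params \<Rightarrow> (real \<Rightarrow> complex) \<Rightarrow> real \<Rightarrow> bool" where
  "admissible_with M \<psi> K \<longleftrightarrow> 0 \<le> K \<and>
     (\<exists>\<Phi>. (\<lambda>(a, \<omega>). \<Phi> a \<omega>) \<in> borel_measurable (lborel \<Otimes>\<^sub>M lborel) \<and>
          (\<forall>a>0. is_saft M (admissibility_arg M \<psi> a) (\<Phi> a)) \<and>
          (AE \<omega> in lborel.
             (\<integral>\<^sup>+a\<in>{0<..}. ennreal (1 / a * (norm (\<Phi> a (a * \<omega>)))\<^sup>2) \<partial>lborel) = ennreal K))"

end

theory Submission
  imports Defs "HOL-Probability.Characteristic_Functions"
begin

text \<open>
  The Moyal identity of the special affine wavelet transform is the Calderon identity of the ordinary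
  wavelet transform in disguise: all quadratic phases drop out. Write \<open>v z = cnj (\<psi> (- z))\<close>, and let
  \<open>F t = f t * cis (A * t\<^sup>2 / (2 * B))\<close> be the chirped signal; chirping is unitary. Up to a factor
  that does not depend on \<open>f\<close> and has modulus \<open>1 / sqrt (2 * pi * a * \<bar>B\<bar>)\<close>, the transform of \<open>f\<close> at
  \<open>(b, a)\<close> is the convolution of \<open>F\<close> with the dilate \<open>v (\<cdot> / a)\<close>. In the same way the transform that
  occurs in the admissibility condition, evaluated at \<open>a * \<omega>\<close>, has the modulus of the Fourier transform
  \<open>V\<close> of \<open>v\<close> at \<open>a * (\<omega> - p) / B\<close>, divided by \<open>sqrt (2 * pi * \<bar>B\<bar>)\<close>. Hence admissibility says that
  \<open>\<integral> \<bar>V (a * w)\<bar>\<^sup>2 / a da\<close> over \<open>a > 0\<close> is \<open>2 * pi * \<bar>B\<bar> * C\<^sub>\<psi>\<close> for almost every \<open>w\<close>.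

  By polarization (\<open>polarization_isometry\<close>) it is enough to treat \<open>f = g\<close>. For fixed \<open>a\<close>, Plancherel's
  theorem turns the integral over \<open>b\<close> into \<open>\<integral> a\<^sup>2 * \<bar>fourier F w * V (a * w)\<bar>\<^sup>2 dw / (2 * pi)\<close>; exchanging the
  integrals over \<open>a\<close> and \<open>w\<close> leaves the constant above times \<open>\<integral> \<bar>fourier F\<bar>\<^sup>2\<close>, and a second use of
  Plancherel's theorem ends the computation (\<open>sqnorm_wavelet_coeff_Cc\<close>).

  The Plancherel theory behind this is kept small. An explicit computation with Gaussian weights gives
  \<open>\<integral> \<bar>fourier u\<bar>\<^sup>2 = 2 * pi * \<integral> \<bar>u\<bar>\<^sup>2\<close> for continuous \<open>u\<close> of compact support only (\<open>plancherel_Cc\<close>). One limit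
  principle, \<open>isometry_limit\<close>, does the rest: if \<open>X\<^sub>n\<close> depends isometrically on \<open>Y\<^sub>n\<close>, if \<open>Y\<^sub>n\<close> converges
  in quadratic mean and \<open>X\<^sub>n\<close> converges pointwise, then the limits correspond isometrically as well. It
  is used twice, to pass from truncations of \<open>v\<close> to \<open>v\<close> itself with \<open>F\<close> continuous of compact support
  (\<open>sqnorm_dilated_conv\<close>), and then from such \<open>F\<close> to all of \<open>L\<^sup>2\<close> (\<open>sqnorm_wavelet_coeff\<close>). The
  Fourier transform of \<open>v\<close> never has to be constructed, because admissibility provides the transform
  for \<open>a = 1\<close> (\<open>admissible_imp_calderon\<close>).
\<close>

section \<open>Squared norms and limits of isometries\<close>

text \<open>
  The square of the norm is taken in \<^typ>\<open>ennreal\<close>, so that finiteness is a conclusion rather than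
  a side condition of Fatou's lemma and of Tonelli's theorem.
\<close>
definition sqnorm :: "'a measure \<Rightarrow> ('a \<Rightarrow> complex) \<Rightarrow> ennreal" where
  "sqnorm M u = (\<integral>\<^sup>+x. ennreal ((cmod (u x))\<^sup>2) \<partial>M)"

lemma sqnorm_cong: "(\<And>x. cmod (u x) = cmod (v x)) \<Longrightarrow> sqnorm M u = sqnorm M v"
  by (simp add: sqnorm_def)

lemma sqnorm_minus_commute: "sqnorm M (\<lambda>x. u x - v x) = sqnorm M (\<lambda>x. v x - u x)"
  by (rule sqnorm_cong) (rule norm_minus_commute)

lemma sqnorm_cmult:
  assumes [measurable]: "u \<in> borel_measurable M"
  shows "sqnorm M (\<lambda>x. c * u x) = ennreal ((cmod c)\<^sup>2) * sqnorm M u"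
  unfolding sqnorm_def
  by (subst nn_integral_cmult[symmetric]) (auto simp: norm_mult power_mult_distrib ennreal_mult)

text \<open>
  A form of the triangle inequality for squares that needs no square roots; the weight \<open>\<delta>\<close> moves the
  constant in front of \<open>\<bar>y\<bar>\<^sup>2\<close> as close to \<open>1\<close> as a limit argument requires.
\<close>
lemma cmod_square_le_weighted:
  fixes x y :: complex
  assumes "\<delta> > 0"
  shows "(cmod x)\<^sup>2 \<le> (1 + \<delta>) * (cmod y)\<^sup>2 + (1 + 1 / \<delta>) * (cmod (x - y))\<^sup>2"
proof -
  have "cmod x \<le> cmod y + cmod (x - y)"
    by (rule norm_triangle_sub)
  then have "(cmod x)\<^sup>2 \<le> (cmod y + cmod (x - y))\<^sup>2"
    by (rule power_mono) simp
  also have "\<dots> \<le> (1 + \<delta>) * (cmod y)\<^sup>2 + (1 + 1 / \<delta>) * (cmod (x - y))\<^sup>2"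
  proof -
    have "0 \<le> (\<delta> * cmod y - cmod (x - y))\<^sup>2 / \<delta>"
      using assms by simp
    then show ?thesis
      using assms by (simp add: power2_eq_square field_simps)
  qed
  finally show ?thesis .
qed

lemma sqnorm_le_weighted:
  assumes [measurable]: "u \<in> borel_measurable M" "v \<in> borel_measurable M" and \<delta>: "\<delta> > 0"
  shows "sqnorm M u \<le> ennreal (1 + \<delta>) * sqnorm M v +
           ennreal (1 + 1 / \<delta>) * sqnorm M (\<lambda>x. u x - v x)"
proof -
  have "sqnorm M u \<le> (\<integral>\<^sup>+x. ennreal (1 + \<delta>) * ennreal ((cmod (v x))\<^sup>2) +
      ennreal (1 + 1 / \<delta>) * ennreal ((cmod (u x - v x))\<^sup>2) \<partial>M)"
    unfolding sqnorm_def
  proof (rule nn_integral_mono)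
    fix x
    show "ennreal ((cmod (u x))\<^sup>2) \<le> ennreal (1 + \<delta>) * ennreal ((cmod (v x))\<^sup>2) +
      ennreal (1 + 1 / \<delta>) * ennreal ((cmod (u x - v x))\<^sup>2)"
    proof -
      have "ennreal ((cmod (u x))\<^sup>2) \<le>
          ennreal ((1 + \<delta>) * (cmod (v x))\<^sup>2 + (1 + 1 / \<delta>) * (cmod (u x - v x))\<^sup>2)"
        by (intro ennreal_leI cmod_square_le_weighted \<delta>)
      also have "\<dots> = ennreal ((1 + \<delta>) * (cmod (v x))\<^sup>2) +
          ennreal ((1 + 1 / \<delta>) * (cmod (u x - v x))\<^sup>2)"
        using \<delta> by (intro ennreal_plus) auto
      finally show ?thesis
        using \<delta> by (subst (1 2) ennreal_mult[symmetric]) auto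
    qed
  qed
  also have "\<dots> = ennreal (1 + \<delta>) * sqnorm M v +
           ennreal (1 + 1 / \<delta>) * sqnorm M (\<lambda>x. u x - v x)"
    unfolding sqnorm_def by (simp add: nn_integral_add nn_integral_cmult)
  finally show ?thesis .
qed

lemma sqnorm_le_twice:
  assumes "u \<in> borel_measurable M" "v \<in> borel_measurable M"
  shows "sqnorm M u \<le> 2 * sqnorm M v + 2 * sqnorm M (\<lambda>x. u x - v x)"
  using sqnorm_le_weighted[OF assms, of 1] by simp

lemma sqnorm_triangle:
  assumes [measurable]: "u \<in> borel_measurable M" "v \<in> borel_measurable M" "w \<in> borel_measurable M"
  shows "sqnorm M (\<lambda>x. u x - v x) \<le>
    2 * sqnorm M (\<lambda>x. u x - w x) + 2 * sqnorm M (\<lambda>x. v x - w x)"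
  using sqnorm_le_twice[of "\<lambda>x. u x - v x" M "\<lambda>x. u x - w x"]
  by (simp add: sqnorm_minus_commute[of M w v])

lemma sqnorm_eq_0_imp_AE_eq:
  assumes [measurable]: "u \<in> borel_measurable M" "v \<in> borel_measurable M"
    and "sqnorm M (\<lambda>x. u x - v x) = 0"
  shows "AE x in M. u x = v x"
  using assms(3) unfolding sqnorm_def
  by (subst (asm) nn_integral_0_iff_AE) (auto simp: ennreal_eq_0_iff)

text \<open>
  With \<open>e\<close> the squared distance, the weighted inequality is applied in both directions with a weight
  slightly above \<open>sqrt e\<close>: then the factor of the norm tends to \<open>1\<close> and the error term stays below
  \<open>e + sqrt e\<close> up to a null sequence.
\<close>
lemma sqnorm_tendsto:
  assumes [measurable]: "\<And>n. X n \<in> borel_measurable M" "Y \<in> borel_measurable M"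
    and fin: "sqnorm M Y < \<infinity>"
    and lim: "(\<lambda>n::nat. sqnorm M (\<lambda>x. X n x - Y x)) \<longlonglongrightarrow> 0"
  shows "(\<lambda>n. sqnorm M (X n)) \<longlonglongrightarrow> sqnorm M Y"
proof -
  define e where "e n = enn2real (sqnorm M (\<lambda>x. X n x - Y x))" for n
  define a where "a = enn2real (sqnorm M Y)"
  (* The second summand keeps the weight positive where e vanishes. *)
  define s where "s n = sqrt (e n) + inverse (real (Suc n))" for n
  have a: "sqnorm M Y = ennreal a" "a \<ge> 0"
    using fin by (auto simp: a_def)
  have e_lim: "e \<longlonglongrightarrow> 0"
    unfolding e_def[abs_def] by (rule tendsto_enn2real) (use lim in simp_all)
  have e_nonneg: "e n \<ge> 0" for n by (simp add: e_def)
  have s_pos: "s n > 0" for n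
    unfolding s_def using e_nonneg by (intro add_nonneg_pos) auto
  have s_lim: "s \<longlonglongrightarrow> 0"
    unfolding s_def
    using tendsto_add[OF tendsto_real_sqrt[OF e_lim] LIMSEQ_inverse_real_of_nat] by simp
  have e_le: "e n / s n \<le> s n" for n
  proof -
    have "e n = (sqrt (e n))\<^sup>2" using e_nonneg by simp
    also have "\<dots> \<le> (s n)\<^sup>2"
      unfolding s_def by (rule power_mono) (use e_nonneg in auto)
    finally show ?thesis
      using s_pos[of n] by (simp add: field_simps power2_eq_square)
  qed
  have ev: "\<forall>\<^sub>F n in sequentially. sqnorm M (\<lambda>x. X n x - Y x) < 1"
    using order_tendstoD(2)[OF lim, of 1] by simp
  have bounds: "\<forall>\<^sub>F n in sequentially.
    sqnorm M (X n) \<le> ennreal ((1 + s n) * a + e n + s n) \<and>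
    sqnorm M (X n) \<ge> ennreal ((a - e n - s n) / (1 + s n))"
    using ev
  proof eventually_elim
    fix n assume "sqnorm M (\<lambda>x. X n x - Y x) < 1"
    then have E: "sqnorm M (\<lambda>x. X n x - Y x) = ennreal (e n)"
      unfolding e_def
      by (intro ennreal_enn2real[symmetric]) (erule order_less_trans, simp)
    have R: "(1 + 1 / s n) * e n \<le> e n + s n"
      using e_le[of n] by (simp add: algebra_simps)
    have "sqnorm M (X n) \<le> ennreal (1 + s n) * ennreal a + ennreal (1 + 1 / s n) * ennreal (e n)"
      using sqnorm_le_weighted[of "X n" M Y "s n"] s_pos E a by simp
    also have "\<dots> = ennreal ((1 + s n) * a + (1 + 1 / s n) * e n)"
      using s_pos[of n] a e_nonneg[of n] by (simp add: ennreal_mult ennreal_plus)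
    also have "\<dots> \<le> ennreal ((1 + s n) * a + e n + s n)"
      by (rule ennreal_leI) (use R in simp)
    finally have up: "sqnorm M (X n) \<le> ennreal ((1 + s n) * a + e n + s n)" .
    then obtain b where b: "sqnorm M (X n) = ennreal b" "b \<ge> 0"
      by (cases "sqnorm M (X n)") (auto simp: top_unique)
    have "ennreal a \<le> ennreal (1 + s n) * ennreal b + ennreal (1 + 1 / s n) * ennreal (e n)"
      using sqnorm_le_weighted[of Y M "X n" "s n"] s_pos E a b
      by (simp add: sqnorm_minus_commute[of M Y])
    also have "\<dots> = ennreal ((1 + s n) * b + (1 + 1 / s n) * e n)"
      using s_pos[of n] b e_nonneg[of n] by (simp add: ennreal_mult ennreal_plus)
    finally have "a \<le> (1 + s n) * b + (1 + 1 / s n) * e n"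
      using s_pos[of n] b e_nonneg[of n] by (subst (asm) ennreal_le_iff) auto
    then have "a \<le> (1 + s n) * b + e n + s n" using R by linarith
    then have "(a - e n - s n) / (1 + s n) \<le> b"
      using s_pos[of n] by (simp add: divide_le_eq mult.commute)
    with up b show "sqnorm M (X n) \<le> ennreal ((1 + s n) * a + e n + s n) \<and>
      sqnorm M (X n) \<ge> ennreal ((a - e n - s n) / (1 + s n))"
      by (auto intro!: ennreal_leI)
  qed
  have u: "(\<lambda>n. ennreal ((1 + s n) * a + e n + s n)) \<longlonglongrightarrow> ennreal a"
    using tendsto_ennrealI[OF tendsto_add[OF tendsto_add[OF tendsto_mult[OF
      tendsto_add[OF tendsto_const s_lim, of 1] tendsto_const[of a]] e_lim] s_lim]] by simp
  have l: "(\<lambda>n. ennreal ((a - e n - s n) / (1 + s n))) \<longlonglongrightarrow> ennreal a"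
    using tendsto_ennrealI[OF tendsto_divide[OF tendsto_diff[OF tendsto_diff[OF
      tendsto_const[of a] e_lim] s_lim] tendsto_add[OF tendsto_const s_lim, of 1]]] by simp
  show ?thesis
    unfolding a
    by (rule tendsto_sandwich[OF _ _ l u]) (use bounds in \<open>auto elim: eventually_mono\<close>)
qed

lemma sqnorm_Fatou:
  assumes [measurable]: "\<And>n. X n \<in> borel_measurable M" "Y \<in> borel_measurable M"
    and "AE x in M. (\<lambda>n::nat. X n x) \<longlonglongrightarrow> Y x"
    and bd: "\<forall>\<^sub>F n in sequentially. sqnorm M (X n) \<le> B n" and B: "B \<longlonglongrightarrow> b"
  shows "sqnorm M Y \<le> b"
proof -
  have "sqnorm M Y = (\<integral>\<^sup>+x. liminf (\<lambda>n. ennreal ((cmod (X n x))\<^sup>2)) \<partial>M)"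
    unfolding sqnorm_def using assms(3)
  proof (intro nn_integral_cong_AE, eventually_elim)
    case (elim x)
    then have "(\<lambda>n. ennreal ((cmod (X n x))\<^sup>2)) \<longlonglongrightarrow> ennreal ((cmod (Y x))\<^sup>2)"
      by (intro tendsto_intros)
    then show ?case
      by (metis lim_imp_Liminf trivial_limit_sequentially)
  qed
  also have "\<dots> \<le> liminf (\<lambda>n. sqnorm M (X n))"
    unfolding sqnorm_def by (rule nn_integral_liminf) simp
  also have "\<dots> \<le> liminf B"
    by (rule Liminf_mono) (rule bd)
  also have "\<dots> = b"
    using B by (simp add: lim_imp_Liminf)
  finally show ?thesis .
qed

text \<open>
  Passing to the limit \<open>m \<rightarrow> \<infinity>\<close> by Fatou's lemma in \<open>\<parallel>X\<^sub>m - X\<^sub>n\<parallel>\<^sup>2 = c * \<parallel>Y\<^sub>m - Y\<^sub>n\<parallel>\<^sup>2\<close> shows that the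
  pointwise limit of \<open>X\<^sub>n\<close> is a limit in quadratic mean, so that the norms converge on both sides.
\<close>
lemma isometry_limit:
  fixes X :: "nat \<Rightarrow> 'a \<Rightarrow> complex" and Y :: "nat \<Rightarrow> 'b \<Rightarrow> complex"
  assumes [measurable]: "\<And>n. X n \<in> borel_measurable M" "X' \<in> borel_measurable M"
      "\<And>n. Y n \<in> borel_measurable N" "Y' \<in> borel_measurable N"
    and X: "AE x in M. (\<lambda>n. X n x) \<longlonglongrightarrow> X' x"
    and Y: "(\<lambda>n. sqnorm N (\<lambda>x. Y n x - Y' x)) \<longlonglongrightarrow> 0"
    and fin: "sqnorm N Y' < \<infinity>" "c < \<infinity>"
    and iso: "\<And>n. sqnorm M (X n) = c * sqnorm N (Y n)"
    and iso_diff: "\<And>m n. sqnorm M (\<lambda>x. X m x - X n x) = c * sqnorm N (\<lambda>x. Y m x - Y n x)"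
  shows "sqnorm M X' = c * sqnorm N Y'"
proof -
  define e where "e n = sqnorm N (\<lambda>x. Y n x - Y' x)" for n
  have e: "e \<longlonglongrightarrow> 0" using Y by (simp add: e_def[abs_def])
  have scaled: "(\<lambda>m. c * (2 * e m + 2 * b)) \<longlonglongrightarrow> c * (2 * 0 + 2 * b)" for b
    using fin(2) by (intro ennreal_tendsto_cmult tendsto_add tendsto_const e) auto
  have le: "sqnorm M (\<lambda>x. X' x - X n x) \<le> c * (2 * 0 + 2 * e n)" for n
  proof (rule sqnorm_Fatou[where X = "\<lambda>m x. X m x - X n x" and B = "\<lambda>m. c * (2 * e m + 2 * e n)"])
    show "AE x in M. (\<lambda>m. X m x - X n x) \<longlonglongrightarrow> X' x - X n x"
      using X by eventually_elim (rule tendsto_diff[OF _ tendsto_const])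
    show "\<forall>\<^sub>F m in sequentially. sqnorm M (\<lambda>x. X m x - X n x) \<le> c * (2 * e m + 2 * e n)"
      unfolding iso_diff e_def
      by (intro always_eventually allI mult_left_mono sqnorm_triangle) auto
    show "(\<lambda>m. c * (2 * e m + 2 * e n)) \<longlonglongrightarrow> c * (2 * 0 + 2 * e n)"
      by (rule scaled)
  qed simp_all
  have X_lim: "(\<lambda>n. sqnorm M (\<lambda>x. X n x - X' x)) \<longlonglongrightarrow> 0"
  proof (rule tendsto_sandwich[OF _ _ tendsto_const])
    show "\<forall>\<^sub>F n in sequentially. sqnorm M (\<lambda>x. X n x - X' x) \<le> c * (2 * e n + 2 * 0)"
      using le by (simp add: sqnorm_minus_commute[of M X'])
    show "(\<lambda>n. c * (2 * e n + 2 * 0)) \<longlonglongrightarrow> 0"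
      using scaled[of 0] by simp
  qed simp
  have Y_norm: "(\<lambda>n. sqnorm N (Y n)) \<longlonglongrightarrow> sqnorm N Y'"
    by (rule sqnorm_tendsto) (use fin Y in auto)
  then have X_norm: "(\<lambda>n. sqnorm M (X n)) \<longlonglongrightarrow> c * sqnorm N Y'"
    unfolding iso using fin(2) by (intro ennreal_tendsto_cmult) auto
  have "sqnorm M X' < \<infinity>"
  proof -
    have 1: "\<forall>\<^sub>F n in sequentially. sqnorm M (X n) < \<infinity>"
      using order_tendstoD(2)[OF X_norm, of \<infinity>] fin by (auto simp: ennreal_mult_less_top)
    have 2: "\<forall>\<^sub>F n in sequentially. sqnorm M (\<lambda>x. X n x - X' x) < \<infinity>"
      using order_tendstoD(2)[OF X_lim, of \<infinity>] by auto
    obtain n where n: "sqnorm M (X n) < \<infinity>" "sqnorm M (\<lambda>x. X n x - X' x) < \<infinity>"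
      using eventually_happens[OF eventually_conj[OF 1 2]] by auto
    have "sqnorm M X' \<le> 2 * sqnorm M (X n) + 2 * sqnorm M (\<lambda>x. X' x - X n x)"
      by (rule sqnorm_le_twice) auto
    also have "\<dots> < \<infinity>"
      using n by (auto simp: sqnorm_minus_commute[of M X'] ennreal_mult_less_top)
    finally show ?thesis .
  qed
  then have "(\<lambda>n. sqnorm M (X n)) \<longlonglongrightarrow> sqnorm M X'"
    by (intro sqnorm_tendsto X_lim) auto
  with X_norm show ?thesis
    by (rule LIMSEQ_unique[symmetric])
qed

section \<open>Density of continuous functions with compact support\<close>

lemma L2_iff: "f \<in> L2 \<longleftrightarrow> f \<in> borel_measurable borel \<and> sqnorm lborel f < \<infinity>"
  by (auto simp: L2_def sqnorm_def integrable_iff_bounded)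

lemma L2_measurable: "f \<in> L2 \<Longrightarrow> f \<in> borel_measurable borel"
  by (simp add: L2_iff)

lemma
  fixes u v :: "'a \<Rightarrow> complex"
  assumes [measurable]: "u \<in> borel_measurable M" "v \<in> borel_measurable M"
    and fin: "sqnorm M u < \<infinity>" "sqnorm M v < \<infinity>"
  shows integrable_mult_sqnorm: "integrable M (\<lambda>x. u x * v x)"
    and Cauchy_Schwarz_sqnorm:
      "ennreal ((cmod (\<integral>x. u x * v x \<partial>M))\<^sup>2) \<le> sqnorm M u * sqnorm M v"
proof -
  have CS: "(\<integral>\<^sup>+x. ennreal (cmod (u x * v x)) \<partial>M)\<^sup>2 \<le> sqnorm M u * sqnorm M v"
    using Cauchy_Schwarz_nn_integral[of "\<lambda>x. ennreal (cmod (u x))" M "\<lambda>x. ennreal (cmod (v x))"]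
    by (simp add: sqnorm_def ennreal_power norm_mult ennreal_mult)
  also have "\<dots> < \<infinity>"
    using fin by (simp add: ennreal_mult_less_top)
  finally have "(\<integral>\<^sup>+x. ennreal (cmod (u x * v x)) \<partial>M) < \<infinity>"
    by (simp add: power_less_top_ennreal)
  then show int: "integrable M (\<lambda>x. u x * v x)"
    by (simp add: integrable_iff_bounded)
  have "ennreal ((cmod (\<integral>x. u x * v x \<partial>M))\<^sup>2) = (ennreal (cmod (\<integral>x. u x * v x \<partial>M)))\<^sup>2"
    by (simp add: ennreal_power)
  also have "\<dots> \<le> (\<integral>\<^sup>+x. ennreal (cmod (u x * v x)) \<partial>M)\<^sup>2"
    by (intro power_mono integral_norm_bound_ennreal int) simp
  also note CS
  finally show "ennreal ((cmod (\<integral>x. u x * v x \<partial>M))\<^sup>2) \<le> sqnorm M u * sqnorm M v" .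
qed

definition Cc :: "(real \<Rightarrow> complex) set" where
  "Cc = {F. continuous_on UNIV F \<and> (\<exists>R. \<forall>x. R < \<bar>x\<bar> \<longrightarrow> F x = 0)}"

lemma CcI: "continuous_on UNIV F \<Longrightarrow> (\<And>x. R < \<bar>x\<bar> \<Longrightarrow> F x = 0) \<Longrightarrow> F \<in> Cc"
  by (auto simp: Cc_def)

lemma Cc_measurable: "F \<in> Cc \<Longrightarrow> F \<in> borel_measurable borel"
  by (auto simp: Cc_def intro: borel_measurable_continuous_onI)

lemma Cc_bound:
  assumes "F \<in> Cc"
  obtains R K where "R > 0" "K > 0" "\<And>x. R < \<bar>x\<bar> \<Longrightarrow> F x = 0"
    "\<And>x. cmod (F x) \<le> K * indicator {-R..R} x" "\<And>x. cmod (F x) \<le> K"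
proof -
  obtain R0 where R0: "\<And>x. R0 < \<bar>x\<bar> \<Longrightarrow> F x = 0" and c: "continuous_on UNIV F"
    using assms by (auto simp: Cc_def)
  define R where "R = \<bar>R0\<bar> + 1"
  have "compact (F ` {-R..R})"
    by (intro compact_continuous_image continuous_on_subset[OF c]) auto
  then obtain K where K: "K > 0" "\<And>x. x \<in> {-R..R} \<Longrightarrow> cmod (F x) \<le> K"
    using compact_imp_bounded bounded_pos by (metis imageI)
  have z: "F x = 0" if "R < \<bar>x\<bar>" for x using R0[of x] that by (simp add: R_def)
  show ?thesis
  proof (rule that[of R K])
    show b: "cmod (F x) \<le> K * indicator {-R..R} x" for x
      using K z[of x] by (auto simp: indicator_def abs_if)
    show "cmod (F x) \<le> K" for x
      using K z[of x] by (cases "x \<in> {-R..R}") (auto simp: abs_if)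
  qed (use K z in \<open>auto simp: R_def\<close>)
qed

lemma Cc_add: assumes "F \<in> Cc" "G \<in> Cc" shows "(\<lambda>x. F x + c * G x) \<in> Cc"
proof -
  obtain R1 R2 where "\<And>x. R1 < \<bar>x\<bar> \<Longrightarrow> F x = 0" "\<And>x. R2 < \<bar>x\<bar> \<Longrightarrow> G x = 0"
    and [continuous_intros]: "continuous_on UNIV F" "continuous_on UNIV G"
    using assms by (auto simp: Cc_def)
  then show ?thesis
    by (intro CcI[where R = "max R1 R2"] continuous_intros) auto
qed

lemma Cc_diff: "F \<in> Cc \<Longrightarrow> G \<in> Cc \<Longrightarrow> (\<lambda>x. F x - G x) \<in> Cc"
  using Cc_add[of F G "-1"] by simp

lemma Cc_integrable:
  assumes "F \<in> Cc" shows "integrable lborel F"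
proof -
  obtain R K where K: "\<And>x. cmod (F x) \<le> K * indicator {-R..R} x" "K > 0"
    using Cc_bound[OF assms] by metis
  show ?thesis
  proof (rule Bochner_Integration.integrable_bound)
    show "integrable lborel (\<lambda>x. K * indicator {-R..R} x)"
      by (intro integrable_mult_right integrable_real_indicator) (auto simp: emeasure_lborel_Icc_eq)
    show "AE x in lborel. norm (F x) \<le> norm (K * indicator {-R..R} x)"
      using K by (auto simp: indicator_def)
  qed (use Cc_measurable[OF assms] in simp)
qed

lemma Cc_subset_L2: assumes "F \<in> Cc" shows "F \<in> L2"
proof -
  obtain R K where K: "\<And>x. cmod (F x) \<le> K * indicator {-R..R} x" "K > 0"
    using Cc_bound[OF assms] by metis
  have "sqnorm lborel F \<le> (\<integral>\<^sup>+x. ennreal (K\<^sup>2) * indicator {-R..R} x \<partial>lborel)"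
    unfolding sqnorm_def
  proof (rule nn_integral_mono)
    fix x
    have "(cmod (F x))\<^sup>2 \<le> (K * indicator {-R..R} x)\<^sup>2"
      by (rule power_mono[OF K(1)]) simp
    then show "ennreal ((cmod (F x))\<^sup>2) \<le> ennreal (K\<^sup>2) * indicator {-R..R} x"
      by (auto simp: indicator_def power_mult_distrib intro: ennreal_leI split: if_splits)
  qed
  also have "\<dots> < \<infinity>"
    by (auto simp: nn_integral_cmult ennreal_mult_less_top emeasure_lborel_Icc_eq)
  finally show ?thesis
    using Cc_measurable[OF assms] by (simp add: L2_iff)
qed

lemma sqnorm_dominated_convergence:
  assumes [measurable]: "\<And>n. X n \<in> borel_measurable M" "Y \<in> borel_measurable M" "w \<in> borel_measurable M"
    and lim: "AE x in M. (\<lambda>n::nat. X n x) \<longlonglongrightarrow> Y x"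
    and bd: "\<And>n. AE x in M. ennreal ((cmod (X n x - Y x))\<^sup>2) \<le> w x"
    and w: "(\<integral>\<^sup>+x. w x \<partial>M) < \<infinity>"
  shows "(\<lambda>n. sqnorm M (\<lambda>x. X n x - Y x)) \<longlonglongrightarrow> 0"
proof -
  have "(\<lambda>n. sqnorm M (\<lambda>x. X n x - Y x)) \<longlonglongrightarrow> (\<integral>\<^sup>+x. 0 \<partial>M)"
    unfolding sqnorm_def
  proof (rule nn_integral_dominated_convergence[where w = w])
    show "AE x in M. (\<lambda>n. ennreal ((cmod (X n x - Y x))\<^sup>2)) \<longlonglongrightarrow> 0"
      using lim
    proof eventually_elim
      case (elim x)
      then have "(\<lambda>n. (cmod (X n x - Y x))\<^sup>2) \<longlonglongrightarrow> (cmod (Y x - Y x))\<^sup>2"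
        by (intro tendsto_power tendsto_norm tendsto_diff tendsto_const)
      from tendsto_ennrealI[OF this] show ?case by simp
    qed
  qed (use bd w in auto)
  then show ?thesis by simp
qed

text \<open>
  A measurable function is an almost everywhere limit of continuous functions \<open>g\<^sub>n\<close>. Projecting the
  values of \<open>g\<^sub>n\<close> radially to the disc of radius \<open>k\<close> and multiplying by a cutoff function that is \<open>1\<close> on
  \<open>[-k, k]\<close> keeps the limit and makes the sequence dominated.
\<close>
lemma Cc_approx_bounded:
  fixes f :: "real \<Rightarrow> complex"
  assumes [measurable]: "f \<in> borel_measurable borel"
    and k: "k > 0" "\<And>x. cmod (f x) \<le> k" "\<And>x. k < \<bar>x\<bar> \<Longrightarrow> f x = 0"
  shows "\<exists>F. (\<forall>n. F n \<in> Cc) \<and> (\<lambda>n. sqnorm lborel (\<lambda>x. F n x - f x)) \<longlonglongrightarrow> 0"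
proof -
  have "f \<in> borel_measurable lebesgue"
    by (intro measurable_completion) simp
  then have "f measurable_on UNIV"
    using lebesgue_measurable_imp_measurable_on[of f UNIV] by simp
  then obtain N g where N: "negligible N" and g: "\<And>n::nat. continuous_on UNIV (g n)"
    "\<And>x. x \<notin> N \<Longrightarrow> (\<lambda>n. g n x) \<longlonglongrightarrow> f x"
    by (auto simp: measurable_on_def)
  (* The cutoff is 1 where f may be nonzero; the radial projection fixes all values of f. *)
  define cut where "cut x = max 0 (min 1 (k + 1 - \<bar>x\<bar>))" for x
  define clamp where "clamp z = (k / max k (cmod z)) *\<^sub>R z" for z :: complex
  define F where "F n x = cut x *\<^sub>R clamp (g n x)" for n x
  have clamp: "cmod (clamp z) \<le> k" for z
    using k(1) by (auto simp: clamp_def max_def field_simps)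
  have clamp_cont: "isCont clamp z" for z
    unfolding clamp_def[abs_def] using k(1) by (intro continuous_intros) auto
  have cut: "0 \<le> cut x" "cut x \<le> 1" "k + 1 < \<bar>x\<bar> \<Longrightarrow> cut x = 0" for x
    by (auto simp: cut_def)
  have F_bound: "cmod (F n x) \<le> k" for n x
    unfolding F_def using mult_mono[of "cut x" 1 "cmod (clamp (g n x))" k] cut[of x] clamp[of "g n x"] by simp
  have F_Cc: "F n \<in> Cc" for n
  proof (rule CcI[where R = "k + 1"])
    have "continuous_on UNIV (clamp \<circ> g n)"
      by (intro continuous_on_compose g continuous_at_imp_continuous_on ballI clamp_cont)
    then show "continuous_on UNIV (F n)"
      unfolding F_def[abs_def] cut_def comp_def by (intro continuous_intros)
  qed (auto simp: F_def cut)
  have [measurable]: "F n \<in> borel_measurable borel" for n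
    by (rule Cc_measurable[OF F_Cc])
  have "(\<lambda>n. sqnorm lborel (\<lambda>x. F n x - f x)) \<longlonglongrightarrow> 0"
  proof (rule sqnorm_dominated_convergence)
    have "AE x in lebesgue. x \<notin> N"
      using N by (simp add: negligible_iff_null_sets AE_not_in)
    then have "AE x in lebesgue. (\<lambda>n. F n x) \<longlonglongrightarrow> f x"
    proof eventually_elim
      case (elim x)
      have "(\<lambda>n. F n x) \<longlonglongrightarrow> cut x *\<^sub>R clamp (f x)"
        unfolding F_def
        by (intro tendsto_scaleR tendsto_const isCont_tendsto_compose[OF clamp_cont] g elim)
      also have "cut x *\<^sub>R clamp (f x) = f x"
        using k(1) k(2)[of x] k(3)[of x] by (cases "k < \<bar>x\<bar>") (auto simp: clamp_def cut_def)
      finally show ?case .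
    qed
    then show "AE x in lborel. (\<lambda>n. F n x) \<longlonglongrightarrow> f x"
      by (simp add: AE_completion_iff)
    show "AE x in lborel. ennreal ((cmod (F n x - f x))\<^sup>2)
        \<le> ennreal ((2 * k)\<^sup>2) * indicator {-(k+1)..k+1} x" for n
    proof (rule AE_I2)
      fix x
      have "cmod (F n x - f x) \<le> 2 * k"
        using norm_triangle_ineq4[of "F n x" "f x"] F_bound[of n x] k(2)[of x] by linarith
      then have "(cmod (F n x - f x))\<^sup>2 \<le> (2 * k)\<^sup>2"
        by (intro power_mono) auto
      moreover have "F n x - f x = 0" if "x \<notin> {-(k+1)..k+1}"
        using that k(1) k(3)[of x] by (auto simp: F_def cut_def)
      ultimately show "ennreal ((cmod (F n x - f x))\<^sup>2)
        \<le> ennreal ((2 * k)\<^sup>2) * indicator {-(k+1)..k+1} x"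
        by (cases "x \<in> {-(k+1)..k+1}") (auto intro: ennreal_leI)
    qed
    show "(\<integral>\<^sup>+x. ennreal ((2 * k)\<^sup>2) * indicator {-(k+1)..k+1} x \<partial>lborel) < \<infinity>"
      by (auto simp: nn_integral_cmult ennreal_mult_less_top emeasure_lborel_Icc_eq)
  qed simp_all
  then show ?thesis using F_Cc by blast
qed

lemma Cc_dense_L2:
  assumes "f \<in> L2"
  obtains F where "\<And>n::nat. F n \<in> Cc" "(\<lambda>n. sqnorm lborel (\<lambda>x. F n x - f x)) \<longlonglongrightarrow> 0"
proof -
  have [measurable]: "f \<in> borel_measurable borel" and fin: "sqnorm lborel f < \<infinity>"
    using assms by (auto simp: L2_iff)
  define h where "h n x = (if \<bar>x\<bar> \<le> real (Suc n) \<and> cmod (f x) \<le> real (Suc n) then f x else 0)" for n x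
  have [measurable]: "h n \<in> borel_measurable borel" for n
    unfolding h_def[abs_def] by measurable
  have h_lim: "(\<lambda>n. sqnorm lborel (\<lambda>x. h n x - f x)) \<longlonglongrightarrow> 0"
  proof (rule sqnorm_dominated_convergence)
    show "AE x in lborel. (\<lambda>n. h n x) \<longlonglongrightarrow> f x"
    proof (rule AE_I2)
      fix x
      obtain m where m: "max \<bar>x\<bar> (cmod (f x)) \<le> real m"
        using real_arch_simple by blast
      have "\<forall>\<^sub>F n in sequentially. h n x = f x"
        using eventually_ge_at_top[of m] by eventually_elim (use m in \<open>auto simp: h_def\<close>)
      then show "(\<lambda>n. h n x) \<longlonglongrightarrow> f x" by (rule tendsto_eventually)
    qed
    show "AE x in lborel. ennreal ((cmod (h n x - f x))\<^sup>2) \<le> ennreal ((cmod (f x))\<^sup>2)" for n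
      by (auto simp: h_def)
  qed (use fin in \<open>simp_all add: sqnorm_def\<close>)
  have "\<exists>F. F \<in> Cc \<and> sqnorm lborel (\<lambda>x. F x - h n x) < ennreal (inverse (real (Suc n)))" for n
  proof -
    have "\<exists>F. (\<forall>m. F m \<in> Cc) \<and> (\<lambda>m. sqnorm lborel (\<lambda>x. F m x - h n x)) \<longlonglongrightarrow> 0"
      by (rule Cc_approx_bounded[where k = "real (Suc n)"]) (auto simp: h_def)
    then obtain F where F: "\<And>m. F m \<in> Cc" "(\<lambda>m. sqnorm lborel (\<lambda>x. F m x - h n x)) \<longlonglongrightarrow> 0"
      by blast
    have "0 < ennreal (inverse (real (Suc n)))" by (simp del: of_nat_Suc)
    from eventually_happens[OF order_tendstoD(2)[OF F(2) this]] show ?thesis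
      using F(1) by auto
  qed
  then obtain F where F: "\<And>n. F n \<in> Cc"
    "\<And>n. sqnorm lborel (\<lambda>x. F n x - h n x) < ennreal (inverse (real (Suc n)))"
    by metis
  have [measurable]: "F n \<in> borel_measurable borel" for n
    by (rule Cc_measurable[OF F(1)])
  show ?thesis
  proof (rule that[OF F(1)])
    show "(\<lambda>n. sqnorm lborel (\<lambda>x. F n x - f x)) \<longlonglongrightarrow> 0"
    proof (rule tendsto_sandwich[OF _ _ tendsto_const])
      show "\<forall>\<^sub>F n in sequentially. sqnorm lborel (\<lambda>x. F n x - f x) \<le>
          2 * ennreal (inverse (real (Suc n))) + 2 * sqnorm lborel (\<lambda>x. h n x - f x)"
      proof (intro always_eventually allI)
        fix n
        have "sqnorm lborel (\<lambda>x. F n x - f x) \<le>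
          2 * sqnorm lborel (\<lambda>x. F n x - h n x) + 2 * sqnorm lborel (\<lambda>x. f x - h n x)"
          by (rule sqnorm_triangle) auto
        also have "\<dots> \<le> 2 * ennreal (inverse (real (Suc n))) + 2 * sqnorm lborel (\<lambda>x. h n x - f x)"
          unfolding sqnorm_minus_commute[of lborel f "h n"]
          by (intro add_mono mult_left_mono order_less_imp_le[OF F(2)]) auto
        finally show "sqnorm lborel (\<lambda>x. F n x - f x) \<le>
          2 * ennreal (inverse (real (Suc n))) + 2 * sqnorm lborel (\<lambda>x. h n x - f x)" .
      qed
      have "(\<lambda>n. 2 * ennreal (inverse (real (Suc n))) + 2 * sqnorm lborel (\<lambda>x. h n x - f x))
        \<longlonglongrightarrow> 2 * ennreal 0 + 2 * 0"
        by (intro tendsto_add ennreal_tendsto_cmult tendsto_ennrealI LIMSEQ_inverse_real_of_nat h_lim)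
           auto
      then show "(\<lambda>n. 2 * ennreal (inverse (real (Suc n))) + 2 * sqnorm lborel (\<lambda>x. h n x - f x))
        \<longlonglongrightarrow> 0" by simp
    qed simp
  qed
qed

section \<open>Plancherel's identity for continuous functions with compact support\<close>

definition fourier :: "(real \<Rightarrow> complex) \<Rightarrow> real \<Rightarrow> complex" where
  "fourier u w = (\<integral>t. u t * cis (- (w * t)) \<partial>lborel)"

lemma borel_measurable_cis [measurable]: "cis \<in> borel_measurable borel"
  by (intro borel_measurable_continuous_onI continuous_intros)

lemma borel_measurable_cnj [measurable]: "cnj \<in> borel_measurable borel"
  by (intro borel_measurable_continuous_onI continuous_intros)

lemma fourier_measurable:
  assumes [measurable]: "u \<in> borel_measurable borel"
  shows "fourier u \<in> borel_measurable borel"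
  unfolding fourier_def[abs_def] by measurable

lemma integrable_mult_cis:
  assumes "integrable lborel u"
  shows "integrable lborel (\<lambda>t. u t * cis (c * t + d))"
proof (rule Bochner_Integration.integrable_bound[OF assms])
  have [measurable]: "u \<in> borel_measurable borel"
    using borel_measurable_integrable[OF assms] by simp
  show "(\<lambda>t. u t * cis (c * t + d)) \<in> borel_measurable lborel" by measurable
qed (simp add: norm_mult)

lemma integrable_fourier_integrand:
  "integrable lborel u \<Longrightarrow> integrable lborel (\<lambda>t. u t * cis (- (w * t)))"
  using integrable_mult_cis[of u "-w" 0] by simp

lemma fourier_bound: "cmod (fourier u w) \<le> (\<integral>t. cmod (u t) \<partial>lborel)"
  unfolding fourier_def
  using integral_norm_bound[of lborel "\<lambda>t. u t * cis (- (w * t))"] by (simp add: norm_mult)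

lemma fourier_diff:
  assumes "integrable lborel u" "integrable lborel v"
  shows "fourier (\<lambda>t. u t - v t) w = fourier u w - fourier v w"
  unfolding fourier_def left_diff_distrib
  by (intro Bochner_Integration.integral_diff integrable_fourier_integrand assms)

text \<open>
  The kernel is symmetric in \<open>t\<close> and \<open>w\<close>, so this is Fubini's theorem.
\<close>
lemma fourier_multiplication:
  assumes u: "integrable lborel u" and v: "integrable lborel v"
  shows "(\<integral>t. u t * fourier v t \<partial>lborel) = (\<integral>w. fourier u w * v w \<partial>lborel)"
proof -
  have [measurable]: "u \<in> borel_measurable borel" "v \<in> borel_measurable borel"
    using borel_measurable_integrable[OF u] borel_measurable_integrable[OF v] by simp_all
  have "integrable (lborel \<Otimes>\<^sub>M lborel) (\<lambda>(t, w). u t * (v w * cis (- (t * w))))"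
  proof (rule lborel_pair.Fubini_integrable)
    have "(\<lambda>t. \<integral>w. norm (case (t, w) of (t, w) \<Rightarrow> u t * (v w * cis (- (t * w)))) \<partial>lborel) =
        (\<lambda>t. norm (u t) * (\<integral>w. norm (v w) \<partial>lborel))"
      by (simp add: norm_mult)
    then show "integrable lborel
        (\<lambda>t. \<integral>w. norm (case (t, w) of (t, w) \<Rightarrow> u t * (v w * cis (- (t * w)))) \<partial>lborel)"
      using u by simp
    show "AE t in lborel. integrable lborel (\<lambda>w. case (t, w) of (t, w) \<Rightarrow> u t * (v w * cis (- (t * w))))"
      using integrable_fourier_integrand[OF v] by simp
  qed measurable
  then have "(\<integral>w. (\<integral>t. u t * (v w * cis (- (t * w))) \<partial>lborel) \<partial>lborel) =
      (\<integral>t. (\<integral>w. u t * (v w * cis (- (t * w))) \<partial>lborel) \<partial>lborel)"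
    by (rule lborel_pair.Fubini_integral)
  moreover have "(\<integral>t. u t * (v w * cis (- (t * w))) \<partial>lborel) = fourier u w * v w" for w
    unfolding fourier_def integral_mult_left_zero[symmetric] by (simp add: mult_ac)
  ultimately show ?thesis
    by (simp add: fourier_def)
qed

text \<open>
  This is the characteristic function of the standard normal distribution, rescaled; it is written as a
  multiple of the normal density because that density acts as an approximate identity below.
\<close>
lemma gaussian_fourier:
  assumes "\<sigma> > 0"
  shows "(\<integral>w. of_real (exp (- (\<sigma> * w)\<^sup>2 / 2)) * cis (y * w) \<partial>lborel) =
    complex_of_real (2 * pi / \<sigma> * std_normal_density (y / \<sigma>))"
proof -
  define \<tau> where "\<tau> = y / \<sigma>"
  have "complex_of_real (exp (- \<tau>\<^sup>2 / 2)) = char std_normal_distribution \<tau>"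
    by (simp add: char_std_normal_distribution)
  also have "\<dots> = (\<integral>x. std_normal_density x *\<^sub>R iexp (\<tau> * x) \<partial>lborel)"
    unfolding char_def by (subst integral_density) (auto simp: normal_density_nonneg)
  also have "\<dots> = (\<integral>x. of_real (1 / sqrt (2 * pi)) *
      (of_real (exp (- x\<^sup>2 / 2)) * cis (\<tau> * x)) \<partial>lborel)"
    by (simp add: std_normal_density_def cis_conv_exp scaleR_conv_of_real mult_ac)
  also have "\<dots> = of_real (1 / sqrt (2 * pi)) *
      (\<integral>x. of_real (exp (- x\<^sup>2 / 2)) * cis (\<tau> * x) \<partial>lborel)"
    by simp
  finally have X: "complex_of_real (exp (- \<tau>\<^sup>2 / 2)) = of_real (1 / sqrt (2 * pi)) *
      (\<integral>x. of_real (exp (- x\<^sup>2 / 2)) * cis (\<tau> * x) \<partial>lborel)" .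
  have \<phi>: "2 * pi * std_normal_density \<tau> = sqrt (2 * pi) * exp (- \<tau>\<^sup>2 / 2)"
  proof -
    have "2 * pi * std_normal_density \<tau> = (2 * pi / sqrt (2 * pi)) * exp (- \<tau>\<^sup>2 / 2)"
      by (simp add: std_normal_density_def)
    also have "2 * pi / sqrt (2 * pi) = sqrt (2 * pi)"
      by (rule real_div_sqrt) simp
    finally show ?thesis .
  qed
  have std: "(\<integral>x. of_real (exp (- x\<^sup>2 / 2)) * cis (\<tau> * x) \<partial>lborel) =
      of_real (2 * pi * std_normal_density \<tau>)"
    unfolding \<phi> of_real_mult X by (simp add: field_simps)
  have "(\<integral>w. of_real (exp (- (\<sigma> * w)\<^sup>2 / 2)) * cis (y * w) \<partial>lborel) =
      \<bar>1 / \<sigma>\<bar> *\<^sub>R (\<integral>x. of_real (exp (- (\<sigma> * (0 + 1 / \<sigma> * x))\<^sup>2 / 2)) * cis (y * (0 + 1 / \<sigma> * x)) \<partial>lborel)"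
    using assms by (intro lborel_integral_real_affine) simp
  also have "\<dots> = (1 / \<sigma>) *\<^sub>R (\<integral>x. of_real (exp (- x\<^sup>2 / 2)) * cis (\<tau> * x) \<partial>lborel)"
    using assms by (simp add: \<tau>_def)
  also have "\<dots> = complex_of_real (2 * pi / \<sigma> * std_normal_density (y / \<sigma>))"
    unfolding std by (simp add: \<tau>_def scaleR_conv_of_real)
  finally show ?thesis .
qed

lemma integrable_gaussian:
  assumes "\<sigma> > 0"
  shows "integrable lborel (\<lambda>w. exp (- (\<sigma> * w)\<^sup>2 / 2) :: real)"
proof -
  have "integrable lborel (\<lambda>x. sqrt (2 * pi) * std_normal_density x)"
    by (intro integrable_mult_right integrable_normal_density) simp
  then have "integrable lborel (\<lambda>x. exp (- x\<^sup>2 / 2) :: real)"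
    by (simp add: std_normal_density_def)
  from lborel_integrable_real_affine[OF this, of \<sigma> 0] assms show ?thesis by simp
qed

text \<open>
  The multiplication formula is used twice: first with a modulated Gaussian, whose transform is a
  translated Gaussian, and then with the Gaussian times the conjugate of the transform of \<open>u\<close>. The
  substitution \<open>s = t + \<sigma> * x\<close> puts the parameter \<open>\<sigma>\<close> into the argument of \<open>u\<close> alone.
\<close>
lemma gaussian_regularized_plancherel:
  assumes u: "u \<in> Cc" and \<sigma>: "\<sigma> > 0"
  shows "complex_of_real (\<integral>w. exp (- (\<sigma> * w)\<^sup>2 / 2) * (cmod (fourier u w))\<^sup>2 \<partial>lborel) =
    of_real (2 * pi) * (\<integral>t. cnj (u t) * (\<integral>x. u (t + \<sigma> * x) * of_real (std_normal_density x) \<partial>lborel) \<partial>lborel)"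
    and "integrable lborel (\<lambda>w. exp (- (\<sigma> * w)\<^sup>2 / 2) * (cmod (fourier u w))\<^sup>2)"
proof -
  define G where "G w = complex_of_real (exp (- (\<sigma> * w)\<^sup>2 / 2))" for w
  have int_u: "integrable lborel u" by (rule Cc_integrable[OF u])
  have [measurable]: "u \<in> borel_measurable borel" by (rule Cc_measurable[OF u])
  note [measurable] = fourier_measurable
  have int_G: "integrable lborel G"
    unfolding G_def[abs_def] by (intro integrable_of_real integrable_gaussian \<sigma>)
  have [measurable]: "G \<in> borel_measurable borel"
    using borel_measurable_integrable[OF int_G] by simp
  define b where "b = (\<integral>t. cmod (u t) \<partial>lborel)"
  have b: "cmod (fourier u w) \<le> b" for w
    unfolding b_def by (rule fourier_bound)
  have int_GF: "integrable lborel (\<lambda>w. G w * cnj (fourier u w))"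
  proof (rule Bochner_Integration.integrable_bound)
    show "integrable lborel (\<lambda>w. G w * of_real b)" using int_G by simp
    show "AE w in lborel. norm (G w * cnj (fourier u w)) \<le> norm (G w * of_real b)"
      by (intro AE_I2) (auto simp: norm_mult intro!: mult_left_mono order_trans[OF b])
  qed measurable
  show "integrable lborel (\<lambda>w. exp (- (\<sigma> * w)\<^sup>2 / 2) * (cmod (fourier u w))\<^sup>2)"
  proof (rule Bochner_Integration.integrable_bound)
    show "integrable lborel (\<lambda>w. exp (- (\<sigma> * w)\<^sup>2 / 2) * b\<^sup>2)"
      using integrable_gaussian[OF \<sigma>] by simp
    show "AE w in lborel. norm (exp (- (\<sigma> * w)\<^sup>2 / 2) * (cmod (fourier u w))\<^sup>2)
        \<le> norm (exp (- (\<sigma> * w)\<^sup>2 / 2) * b\<^sup>2)"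
      by (intro AE_I2) (auto intro!: power_mono b)
  qed measurable
  have inner: "(\<integral>w. fourier u w * (G w * cis (w * t)) \<partial>lborel) =
      of_real (2 * pi) * (\<integral>x. u (t + \<sigma> * x) * of_real (std_normal_density x) \<partial>lborel)" for t
  proof -
    have hat: "fourier (\<lambda>w. G w * cis (w * t)) s =
        of_real (2 * pi / \<sigma> * std_normal_density ((t - s) / \<sigma>))" for s
    proof -
      have "cis (w * t) * cis (- (s * w)) = cis ((t - s) * w)" for w
        by (simp add: cis_mult algebra_simps)
      then show ?thesis
        unfolding gaussian_fourier[OF \<sigma>, symmetric] fourier_def G_def mult.assoc by simp
    qed
    have "integrable lborel (\<lambda>w. G w * cis (w * t))"
      using integrable_mult_cis[OF int_G, of t 0] by (simp add: mult.commute)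
    from fourier_multiplication[OF int_u this]
    have "(\<integral>w. fourier u w * (G w * cis (w * t)) \<partial>lborel) =
        (\<integral>s. u s * of_real (2 * pi / \<sigma> * std_normal_density ((t - s) / \<sigma>)) \<partial>lborel)"
      unfolding hat by simp
    also have "(\<integral>s. u s * of_real (2 * pi / \<sigma> * std_normal_density ((t - s) / \<sigma>)) \<partial>lborel) =
      \<bar>\<sigma>\<bar> *\<^sub>R (\<integral>x. u (t + \<sigma> * x) * of_real (2 * pi / \<sigma> * std_normal_density ((t - (t + \<sigma> * x)) / \<sigma>)) \<partial>lborel)"
      using \<sigma> by (intro lborel_integral_real_affine) simp
    also have "\<dots> = \<sigma> *\<^sub>R (\<integral>x. of_real (2 * pi / \<sigma>) * (u (t + \<sigma> * x) * of_real (std_normal_density x)) \<partial>lborel)"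
      using \<sigma> by (simp add: std_normal_density_def mult_ac)
    also have "\<dots> = of_real (2 * pi) * (\<integral>x. u (t + \<sigma> * x) * of_real (std_normal_density x) \<partial>lborel)"
      using \<sigma> by (simp add: scaleR_conv_of_real)
    finally show ?thesis .
  qed
  have conj: "cnj (fourier (\<lambda>w. G w * cnj (fourier u w)) t) =
      (\<integral>w. fourier u w * (G w * cis (w * t)) \<partial>lborel)" for t
  proof -
    have "cnj (G w * cnj (fourier u w) * cis (- (t * w))) = fourier u w * (G w * cis (w * t))" for w
      by (simp add: G_def cis_cnj mult_ac)
    moreover have "cnj (fourier (\<lambda>w. G w * cnj (fourier u w)) t) =
        (\<integral>w. cnj (G w * cnj (fourier u w) * cis (- (t * w))) \<partial>lborel)"
      unfolding fourier_def[of "\<lambda>w. G w * cnj (fourier u w)"] by (rule Bochner_Integration.integral_cnj[symmetric])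
    ultimately show ?thesis
      by (simp only:)
  qed
  have real: "complex_of_real (\<integral>w. exp (- (\<sigma> * w)\<^sup>2 / 2) * (cmod (fourier u w))\<^sup>2 \<partial>lborel) =
      (\<integral>w. fourier u w * (G w * cnj (fourier u w)) \<partial>lborel)"
  proof -
    have "(\<integral>w. fourier u w * (G w * cnj (fourier u w)) \<partial>lborel) =
        (\<integral>w. complex_of_real (exp (- (\<sigma> * w)\<^sup>2 / 2) * (cmod (fourier u w))\<^sup>2) \<partial>lborel)"
      by (simp only: complex_norm_square of_real_mult G_def mult_ac)
    then show ?thesis
      by (simp only: integral_complex_of_real)
  qed
  (* The integral is real; conjugating it makes the conjugate fall on u after the next step. *)
  also have "\<dots> = cnj (\<integral>w. fourier u w * (G w * cnj (fourier u w)) \<partial>lborel)"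
    by (simp only: real[symmetric] complex_cnj_complex_of_real)
  also have "\<dots> = cnj (\<integral>t. u t * fourier (\<lambda>w. G w * cnj (fourier u w)) t \<partial>lborel)"
    by (simp add: fourier_multiplication[OF int_u int_GF])
  also have "\<dots> = (\<integral>t. cnj (u t * fourier (\<lambda>w. G w * cnj (fourier u w)) t) \<partial>lborel)"
    by (rule Bochner_Integration.integral_cnj[symmetric])
  also have "\<dots> = (\<integral>t. cnj (u t) * (\<integral>w. fourier u w * (G w * cis (w * t)) \<partial>lborel) \<partial>lborel)"
    by (simp only: complex_cnj_mult conj)
  also have "\<dots> = of_real (2 * pi) * (\<integral>t. cnj (u t) * (\<integral>x. u (t + \<sigma> * x) * of_real (std_normal_density x) \<partial>lborel) \<partial>lborel)"
    unfolding inner integral_mult_right_zero[symmetric] by (simp add: mult_ac)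
  finally show "complex_of_real (\<integral>w. exp (- (\<sigma> * w)\<^sup>2 / 2) * (cmod (fourier u w))\<^sup>2 \<partial>lborel) =
    of_real (2 * pi) * (\<integral>t. cnj (u t) * (\<integral>x. u (t + \<sigma> * x) * of_real (std_normal_density x) \<partial>lborel) \<partial>lborel)" .
qed

lemma gaussian_mollification_limit:
  assumes u: "u \<in> Cc" and \<sigma>: "\<sigma> \<longlonglongrightarrow> 0"
  shows "(\<lambda>n::nat. \<integral>t. cnj (u t) * (\<integral>x. u (t + \<sigma> n * x) * of_real (std_normal_density x) \<partial>lborel) \<partial>lborel)
    \<longlonglongrightarrow> of_real (\<integral>t. (cmod (u t))\<^sup>2 \<partial>lborel)"
proof -
  obtain K where K: "K > 0" "\<And>x. cmod (u x) \<le> K"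
    using Cc_bound[OF u] by metis
  have [measurable]: "u \<in> borel_measurable borel" by (rule Cc_measurable[OF u])
  define J where "J n t = (\<integral>x. u (t + \<sigma> n * x) * of_real (std_normal_density x) \<partial>lborel)" for n t
  have std_int: "integrable lborel std_normal_density" "(\<integral>x. std_normal_density x \<partial>lborel) = 1"
    by (auto intro: integrable_normal_density)
  have bound: "norm (u (t + \<sigma> n * x) * of_real (std_normal_density x)) \<le> K * std_normal_density x" for t n x
    using K by (auto simp: norm_mult normal_density_nonneg intro!: mult_right_mono)
  have [measurable]: "J n \<in> borel_measurable borel" for n
    unfolding J_def[abs_def] by measurable
  have J_bound: "cmod (J n t) \<le> K" for n t
  proof -
    have "cmod (J n t) \<le> (\<integral>x. K * std_normal_density x \<partial>lborel)"
      unfolding J_def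
    proof (rule order_trans[OF integral_norm_bound])
      show "(\<integral>x. norm (u (t + \<sigma> n * x) * of_real (std_normal_density x)) \<partial>lborel) \<le>
          (\<integral>x. K * std_normal_density x \<partial>lborel)"
        by (intro integral_mono_AE' AE_I2 bound) (use std_int K in \<open>auto simp: normal_density_nonneg\<close>)
    qed
    then show ?thesis by (simp add: std_int)
  qed
  have J_lim: "(\<lambda>n. J n t) \<longlonglongrightarrow> u t" for t
  proof -
    have "(\<lambda>n. J n t) \<longlonglongrightarrow> (\<integral>x. u t * of_real (std_normal_density x) \<partial>lborel)"
      unfolding J_def
    proof (rule integral_dominated_convergence[where w = "\<lambda>x. K * std_normal_density x"])
      show "AE x in lborel. (\<lambda>n. u (t + \<sigma> n * x) * of_real (std_normal_density x))
          \<longlonglongrightarrow> u t * of_real (std_normal_density x)"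
      proof (rule AE_I2)
        fix x
        have "isCont u t" using u by (simp add: Cc_def continuous_on_eq_continuous_at)
        moreover have "(\<lambda>n. t + \<sigma> n * x) \<longlonglongrightarrow> t + 0 * x"
          by (intro tendsto_add tendsto_mult tendsto_const \<sigma>)
        ultimately have "(\<lambda>n. u (t + \<sigma> n * x)) \<longlonglongrightarrow> u t"
          using isCont_tendsto_compose[of t u] by simp
        then show "(\<lambda>n. u (t + \<sigma> n * x) * of_real (std_normal_density x))
          \<longlonglongrightarrow> u t * of_real (std_normal_density x)"
          by (rule tendsto_mult_right)
      qed
    qed (use std_int bound in auto)
    also have "(\<integral>x. u t * of_real (std_normal_density x) \<partial>lborel) = u t"
      by (simp add: std_int)
    finally show ?thesis .
  qed
  have "(\<lambda>n. \<integral>t. cnj (u t) * J n t \<partial>lborel) \<longlonglongrightarrow> (\<integral>t. cnj (u t) * u t \<partial>lborel)"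
  proof (rule integral_dominated_convergence[where w = "\<lambda>t. cmod (u t) * K"])
    show "integrable lborel (\<lambda>t. cmod (u t) * K)"
      using Cc_integrable[OF u] by simp
    show "AE t in lborel. (\<lambda>n. cnj (u t) * J n t) \<longlonglongrightarrow> cnj (u t) * u t"
      by (intro AE_I2 tendsto_mult tendsto_const J_lim)
    show "AE t in lborel. norm (cnj (u t) * J n t) \<le> cmod (u t) * K" for n
      by (intro AE_I2) (auto simp: norm_mult intro!: mult_left_mono J_bound)
  qed measurable
  also have "(\<integral>t. cnj (u t) * u t \<partial>lborel) = of_real (\<integral>t. (cmod (u t))\<^sup>2 \<partial>lborel)"
  proof -
    have "(\<integral>t. cnj (u t) * u t \<partial>lborel) = (\<integral>t. complex_of_real ((cmod (u t))\<^sup>2) \<partial>lborel)"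
      by (simp only: complex_norm_square mult.commute)
    also have "\<dots> = of_real (\<integral>t. (cmod (u t))\<^sup>2 \<partial>lborel)"
      by (rule integral_complex_of_real)
    finally show ?thesis .
  qed
  finally show ?thesis by (simp add: J_def)
qed

text \<open>
  As \<open>\<sigma> \<rightarrow> 0\<close> the Gaussian weight increases to \<open>1\<close>, so the left-hand side of the regularized identity
  converges by monotone convergence; that gives square integrability of the transform at the same time.
\<close>
theorem plancherel_Cc:
  assumes u: "u \<in> Cc"
  shows "sqnorm lborel (fourier u) = ennreal (2 * pi) * sqnorm lborel u"
proof -
  (* Decreasing, so that the Gaussian weights increase with n. *)
  define \<sigma> where "\<sigma> n = inverse (real (Suc n))" for n
  define I where "I n = (\<integral>w. exp (- (\<sigma> n * w)\<^sup>2 / 2) * (cmod (fourier u w))\<^sup>2 \<partial>lborel)" for n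
  have \<sigma>: "\<sigma> n > 0" for n by (simp add: \<sigma>_def)
  have \<sigma>_lim: "\<sigma> \<longlonglongrightarrow> 0"
    unfolding \<sigma>_def[abs_def] by (rule LIMSEQ_inverse_real_of_nat)
  have [measurable]: "u \<in> borel_measurable borel" by (rule Cc_measurable[OF u])
  note [measurable] = fourier_measurable
  have "(\<lambda>n. complex_of_real (I n)) \<longlonglongrightarrow> of_real (2 * pi) * of_real (\<integral>t. (cmod (u t))\<^sup>2 \<partial>lborel)"
    unfolding I_def gaussian_regularized_plancherel(1)[OF u \<sigma>]
    by (intro tendsto_mult tendsto_const gaussian_mollification_limit u \<sigma>_lim)
  then have "I \<longlonglongrightarrow> 2 * pi * (\<integral>t. (cmod (u t))\<^sup>2 \<partial>lborel)"
    unfolding of_real_mult[symmetric] tendsto_of_real_iff .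
  then have "(\<lambda>n. ennreal (I n)) \<longlonglongrightarrow> ennreal (2 * pi * (\<integral>t. (cmod (u t))\<^sup>2 \<partial>lborel))"
    by (rule tendsto_ennrealI)
  also have "ennreal (2 * pi * (\<integral>t. (cmod (u t))\<^sup>2 \<partial>lborel)) = ennreal (2 * pi) * sqnorm lborel u"
  proof -
    have "integrable lborel (\<lambda>t. (cmod (u t))\<^sup>2)"
      using Cc_subset_L2[OF u] by (simp add: L2_def)
    then show ?thesis
      unfolding sqnorm_def by (subst nn_integral_eq_integral) (auto simp: ennreal_mult)
  qed
  finally have lim1: "(\<lambda>n. ennreal (I n)) \<longlonglongrightarrow> ennreal (2 * pi) * sqnorm lborel u" .
  have I_nn: "ennreal (I n) =
      (\<integral>\<^sup>+w. ennreal (exp (- (\<sigma> n * w)\<^sup>2 / 2) * (cmod (fourier u w))\<^sup>2) \<partial>lborel)" for n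
    unfolding I_def
    by (rule nn_integral_eq_integral[symmetric, OF gaussian_regularized_plancherel(2)[OF u \<sigma>]]) simp
  have "(\<lambda>n. ennreal (I n)) \<longlonglongrightarrow> sqnorm lborel (fourier u)"
    unfolding I_nn sqnorm_def
  proof (rule nn_integral_LIMSEQ)
    show "incseq (\<lambda>n w. ennreal (exp (- (\<sigma> n * w)\<^sup>2 / 2) * (cmod (fourier u w))\<^sup>2))"
    proof (intro incseq_SucI le_funI ennreal_leI mult_right_mono)
      fix n w
      have "\<sigma> (Suc n) \<le> \<sigma> n" by (simp add: \<sigma>_def field_simps)
      then have "(\<sigma> (Suc n))\<^sup>2 * w\<^sup>2 \<le> (\<sigma> n)\<^sup>2 * w\<^sup>2"
        using \<sigma>[of "Suc n"] by (intro mult_right_mono power_mono) auto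
      then show "exp (- (\<sigma> n * w)\<^sup>2 / 2) \<le> exp (- (\<sigma> (Suc n) * w)\<^sup>2 / 2)"
        by (simp add: power_mult_distrib)
    qed simp
    fix w
    have "(\<lambda>n. exp (- (\<sigma> n * w)\<^sup>2 / 2) * (cmod (fourier u w))\<^sup>2)
        \<longlonglongrightarrow> exp (- (0 * w)\<^sup>2 / 2) * (cmod (fourier u w))\<^sup>2"
      by (intro tendsto_intros \<sigma>_lim) simp
    then show "(\<lambda>n. ennreal (exp (- (\<sigma> n * w)\<^sup>2 / 2) * (cmod (fourier u w))\<^sup>2))
        \<longlonglongrightarrow> ennreal ((cmod (fourier u w))\<^sup>2)"
      by (intro tendsto_ennrealI) simp
  qed measurable
  from LIMSEQ_unique[OF this lim1] show ?thesis .
qed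

section \<open>Plancherel's identity for convolutions with square integrable functions\<close>

text \<open>
  The convolution of \<open>F\<close> with the dilate \<open>v (\<cdot> / a)\<close>, evaluated at \<open>b\<close>.
\<close>
definition dilated_conv :: "(real \<Rightarrow> complex) \<Rightarrow> (real \<Rightarrow> complex) \<Rightarrow> real \<Rightarrow> real \<Rightarrow> complex" where
  "dilated_conv F v a b = (\<integral>t. F t * v ((b - t) / a) \<partial>lborel)"

definition truncate :: "(real \<Rightarrow> complex) \<Rightarrow> nat \<Rightarrow> real \<Rightarrow> complex" where
  "truncate v n x = indicator {- real n..real n} x *\<^sub>R v x"

text \<open>
  The Fourier transform on \<open>L\<^sup>2\<close> as a relation, in the same sense in which the special affine transform
  is a relation: both are limits in quadratic mean over the same truncations.
\<close>
definition plancherel_transform :: "(real \<Rightarrow> complex) \<Rightarrow> (real \<Rightarrow> complex) \<Rightarrow> bool" where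
  "plancherel_transform v V \<longleftrightarrow> V \<in> L2 \<and>
     (\<lambda>n. sqnorm lborel (\<lambda>w. fourier (truncate v n) w - V w)) \<longlonglongrightarrow> 0"

lemma sqnorm_affine:
  assumes [measurable]: "u \<in> borel_measurable borel" and c: "c \<noteq> 0"
  shows "sqnorm lborel u = ennreal \<bar>c\<bar> * sqnorm lborel (\<lambda>x. u (t + c * x))"
  unfolding sqnorm_def by (rule nn_integral_real_affine) (use c in auto)

lemma L2_affine:
  assumes "u \<in> L2" and c: "c \<noteq> 0"
  shows "(\<lambda>x. u (t + c * x)) \<in> L2"
proof -
  have [measurable]: "u \<in> borel_measurable borel" by (rule L2_measurable[OF assms(1)])
  have "sqnorm lborel u < \<infinity>" using assms by (simp add: L2_iff)
  then show ?thesis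
    using c unfolding sqnorm_affine[OF \<open>u \<in> borel_measurable borel\<close> c, of t]
    by (auto simp: L2_iff ennreal_mult_less_top)
qed

lemma truncate_measurable [measurable]:
  "v \<in> borel_measurable borel \<Longrightarrow> truncate v n \<in> borel_measurable borel"
  unfolding truncate_def[abs_def] by measurable

lemma integrable_truncate:
  assumes "v \<in> L2" shows "integrable lborel (truncate v n)"
proof -
  have [measurable]: "v \<in> borel_measurable borel" by (rule L2_measurable[OF assms])
  have "sqnorm lborel (indicator {- real n..real n}) =
      (\<integral>\<^sup>+x. indicator {- real n..real n} x \<partial>lborel)"
    unfolding sqnorm_def by (intro nn_integral_cong) (auto simp: indicator_def)
  then have "integrable lborel (\<lambda>x. indicator {- real n..real n} x * v x)"
    using assms by (intro integrable_mult_sqnorm) (auto simp: L2_iff emeasure_lborel_Icc_eq)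
  moreover have "truncate v n = (\<lambda>x. indicator {- real n..real n} x * v x)"
    by (auto simp: truncate_def indicator_def)
  ultimately show ?thesis by simp
qed

lemma dilated_conv_substitute:
  assumes "a > 0"
  shows "dilated_conv F v a b = of_real a * (\<integral>s. F (b - a * s) * v s \<partial>lborel)"
proof -
  have "dilated_conv F v a b =
      \<bar>- a\<bar> *\<^sub>R (\<integral>s. F (b + - a * s) * v ((b - (b + - a * s)) / a) \<partial>lborel)"
    unfolding dilated_conv_def using assms by (intro lborel_integral_real_affine) simp
  then show ?thesis using assms by (simp add: scaleR_conv_of_real)
qed

text \<open>
  After the substitution \<open>t = b - a * s\<close> the parameter \<open>b\<close> occurs in the continuous bounded factor only,
  and the truncated \<open>v\<close> is integrable.
\<close>
lemma dilated_conv_truncate_Cc: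
  assumes F: "F \<in> Cc" and v: "v \<in> L2" and a: "a > 0"
  shows "dilated_conv F (truncate v n) a \<in> Cc"
proof -
  obtain R K where K: "K > 0" "R > 0" "\<And>x. cmod (F x) \<le> K" "\<And>x. R < \<bar>x\<bar> \<Longrightarrow> F x = 0"
    using Cc_bound[OF F] by metis
  have [measurable]: "v \<in> borel_measurable borel" "F \<in> borel_measurable borel"
    by (rule L2_measurable[OF v], rule Cc_measurable[OF F])
  have cont: "isCont F x" for x
    using F by (simp add: Cc_def continuous_on_eq_continuous_at)
  show ?thesis
  proof (rule CcI[where R = "R + a * real n"])
    have "isCont (\<lambda>b. \<integral>s. F (b - a * s) * truncate v n s \<partial>lborel) b" for b
      unfolding continuous_at_sequentially comp_def
    proof (intro allI impI)
      fix x :: "nat \<Rightarrow> real" assume x: "x \<longlonglongrightarrow> b"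
      show "(\<lambda>m. \<integral>s. F (x m - a * s) * truncate v n s \<partial>lborel)
          \<longlonglongrightarrow> (\<integral>s. F (b - a * s) * truncate v n s \<partial>lborel)"
      proof (rule integral_dominated_convergence[where w = "\<lambda>s. K * cmod (truncate v n s)"])
        show "integrable lborel (\<lambda>s. K * cmod (truncate v n s))"
          using integrable_truncate[OF v] by simp
        show "AE s in lborel. (\<lambda>m. F (x m - a * s) * truncate v n s)
            \<longlonglongrightarrow> F (b - a * s) * truncate v n s"
          by (intro AE_I2 tendsto_mult_right isCont_tendsto_compose[OF cont]
              tendsto_diff tendsto_const x)
        show "AE s in lborel. norm (F (x m - a * s) * truncate v n s)
            \<le> K * cmod (truncate v n s)" for m
          by (intro AE_I2) (auto simp: norm_mult intro!: mult_right_mono K)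
      qed measurable
    qed
    then show "continuous_on UNIV (dilated_conv F (truncate v n) a)"
      unfolding dilated_conv_substitute[OF a, abs_def]
      by (intro continuous_intros continuous_at_imp_continuous_on ballI)
    fix b assume b: "R + a * real n < \<bar>b\<bar>"
    have "F (b - a * s) * truncate v n s = 0" for s
    proof (cases "\<bar>s\<bar> \<le> real n")
      case True
      then have "\<bar>a * s\<bar> \<le> a * real n" using a by (simp add: abs_mult)
      then have "R < \<bar>b - a * s\<bar>" using b by linarith
      then show ?thesis using K by simp
    next
      case False
      then show ?thesis by (auto simp: truncate_def indicator_def abs_le_iff)
    qed
    then show "dilated_conv F (truncate v n) a b = 0"
      unfolding dilated_conv_substitute[OF a] by (simp only: Bochner_Integration.integral_zero mult_zero_right)
  qed
qed

lemma fourier_dilated_conv: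
  assumes F: "integrable lborel F" and v: "integrable lborel v" and a: "a > 0"
  shows "fourier (dilated_conv F v a) w = of_real a * fourier F w * fourier v (a * w)"
proof -
  have [measurable]: "F \<in> borel_measurable borel" "v \<in> borel_measurable borel"
    using borel_measurable_integrable[OF F] borel_measurable_integrable[OF v] by simp_all
  have int_F: "integrable lborel (\<lambda>b. F (b - a * s))" for s
    using lborel_integrable_real_affine[OF F, of 1 "- a * s"] by simp
  have norm_F: "(\<integral>b. cmod (F (b - a * s)) \<partial>lborel) = (\<integral>b. cmod (F b) \<partial>lborel)" for s
    using lborel_integral_real_affine[of 1 "\<lambda>b. cmod (F b)" "- a * s"] by simp
  define k where "k s b = F (b - a * s) * v s * cis (- (w * b))" for s b
  have k_norm: "norm (k s b) = cmod (v s) * cmod (F (b - a * s))" for s b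
    by (simp add: k_def norm_mult)
  have k_int: "integrable lborel (k s)" for s
    unfolding k_def[abs_def] using int_F by (intro integrable_fourier_integrand) simp
  have "integrable (lborel \<Otimes>\<^sub>M lborel) (case_prod k)"
  proof (rule lborel_pair.Fubini_integrable)
    show "integrable lborel (\<lambda>s. \<integral>b. norm (case (s, b) of (s, b) \<Rightarrow> k s b) \<partial>lborel)"
      using v by (simp add: k_norm norm_F)
    show "case_prod k \<in> borel_measurable (lborel \<Otimes>\<^sub>M lborel)"
      unfolding k_def[abs_def] by measurable
  qed (use k_int in simp)
  then have swap: "(\<integral>b. (\<integral>s. k s b \<partial>lborel) \<partial>lborel) = (\<integral>s. (\<integral>b. k s b \<partial>lborel) \<partial>lborel)"
    by (rule lborel_pair.Fubini_integral)
  have inner: "(\<integral>b. k s b \<partial>lborel) = fourier F w * (v s * cis (- (a * w * s)))" for s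
  proof -
    have "(\<integral>b. k s b \<partial>lborel) = \<bar>1\<bar> *\<^sub>R (\<integral>x. k s (a * s + 1 * x) \<partial>lborel)"
      by (rule lborel_integral_real_affine) simp
    also have "(\<lambda>x. k s (a * s + 1 * x)) = (\<lambda>x. (F x * cis (- (w * x))) * (v s * cis (- (a * w * s))))"
      by (rule ext) (simp add: k_def cis_mult algebra_simps)
    finally show ?thesis
      by (simp add: fourier_def)
  qed
  have "fourier (dilated_conv F v a) w = of_real a * (\<integral>b. (\<integral>s. k s b \<partial>lborel) \<partial>lborel)"
    unfolding fourier_def dilated_conv_substitute[OF a] k_def
    by (simp add: mult.assoc flip: integral_mult_left_zero)
  also have "\<dots> = of_real a * (fourier F w * fourier v (a * w))"
    unfolding swap inner by (simp add: fourier_def)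
  finally show ?thesis by (simp add: mult.assoc)
qed

text \<open>
  For truncated \<open>v\<close> the convolution is continuous of compact support and its transform is a product, so
  \<open>plancherel_Cc\<close> applies. In the limit the products converge in quadratic mean because the transform of
  \<open>F\<close> is bounded; the convolutions even become stationary at each point, since \<open>F\<close> has compact
  support.
\<close>
lemma sqnorm_dilated_conv:
  assumes F: "F \<in> Cc" and v: "v \<in> L2" and V: "plancherel_transform v V" and a: "a > 0"
  shows "sqnorm lborel (dilated_conv F v a) =
    ennreal (1 / (2 * pi)) * sqnorm lborel (\<lambda>w. of_real a * fourier F w * V (a * w))"
proof (rule isometry_limit)
  define X where "X n = dilated_conv F (truncate v n) a" for n
  define Y where "Y n w = of_real a * fourier F w * fourier (truncate v n) (a * w)" for n w
  have V_L2: "V \<in> L2" and V_lim: "(\<lambda>n. sqnorm lborel (\<lambda>w. fourier (truncate v n) w - V w)) \<longlonglongrightarrow> 0"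
    using V by (auto simp: plancherel_transform_def)
  have [measurable]: "v \<in> borel_measurable borel" "F \<in> borel_measurable borel" "V \<in> borel_measurable borel"
    by (rule L2_measurable[OF v], rule Cc_measurable[OF F], rule L2_measurable[OF V_L2])
  note [measurable] = fourier_measurable
  have F_int: "integrable lborel F" by (rule Cc_integrable[OF F])
  have X_Cc: "X n \<in> Cc" for n
    unfolding X_def by (rule dilated_conv_truncate_Cc[OF F v a])
  have fourier_X: "fourier (X n) = Y n" for n
    unfolding X_def Y_def[abs_def] by (rule ext) (rule fourier_dilated_conv[OF F_int integrable_truncate[OF v] a])
  have iso: "sqnorm lborel u = ennreal (1 / (2 * pi)) * sqnorm lborel (fourier u)" if "u \<in> Cc" for u
    unfolding plancherel_Cc[OF that] by (simp add: mult.assoc[symmetric] flip: ennreal_mult)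
  show "X n \<in> borel_measurable lborel" "Y n \<in> borel_measurable lborel" for n
    using Cc_measurable[OF X_Cc] unfolding fourier_X[symmetric] by (auto intro: fourier_measurable)
  show "dilated_conv F v a \<in> borel_measurable lborel"
    unfolding dilated_conv_def[abs_def] by measurable
  show "(\<lambda>w. of_real a * fourier F w * V (a * w)) \<in> borel_measurable lborel"
    by measurable
  show "sqnorm lborel (X n) = ennreal (1 / (2 * pi)) * sqnorm lborel (Y n)" for n
    unfolding iso[OF X_Cc] fourier_X ..
  show "sqnorm lborel (\<lambda>x. X m x - X n x) = ennreal (1 / (2 * pi)) * sqnorm lborel (\<lambda>x. Y m x - Y n x)" for m n
  proof -
    have "fourier (\<lambda>x. X m x - X n x) = (\<lambda>x. Y m x - Y n x)"
      unfolding fourier_X[symmetric] by (rule ext) (intro fourier_diff Cc_integrable X_Cc)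
    then show ?thesis
      using iso[OF Cc_diff[OF X_Cc X_Cc]] by simp
  qed
  obtain R where R: "\<And>x. R < \<bar>x\<bar> \<Longrightarrow> F x = 0"
    using Cc_bound[OF F] by metis
  show "AE b in lborel. (\<lambda>n. X n b) \<longlonglongrightarrow> dilated_conv F v a b"
  proof (rule AE_I2, rule tendsto_eventually)
    fix b
    obtain N where N: "(\<bar>b\<bar> + \<bar>R\<bar>) / a \<le> real N"
      using real_arch_simple by blast
    show "\<forall>\<^sub>F n in sequentially. X n b = dilated_conv F v a b"
      using eventually_ge_at_top[of N]
    proof eventually_elim
      fix n assume n: "N \<le> n"
      have "F t * truncate v n ((b - t) / a) = F t * v ((b - t) / a)" for t
      proof (cases "R < \<bar>t\<bar>")
        case False
        then have "\<bar>b - t\<bar> / a \<le> (\<bar>b\<bar> + \<bar>R\<bar>) / a"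
          using a by (intro divide_right_mono) linarith+
        also have "\<dots> \<le> real n" using N n by simp
        finally have "\<bar>(b - t) / a\<bar> \<le> real n" using a by (simp add: abs_divide)
        then have "(b - t) / a \<in> {- real n..real n}"
          unfolding abs_le_iff by simp
        then show ?thesis by (simp add: truncate_def)
      qed (simp add: R)
      then show "X n b = dilated_conv F v a b"
        unfolding X_def dilated_conv_def by (simp only:)
    qed
  qed
  define k where "k = (\<integral>t. cmod (F t) \<partial>lborel)"
  have k: "cmod (fourier F w) \<le> k" for w
    unfolding k_def by (rule fourier_bound)
  have weight: "sqnorm lborel (\<lambda>w. of_real a * fourier F w * u (a * w)) \<le>
      ennreal ((a * k)\<^sup>2 / a) * sqnorm lborel u"
    if [measurable]: "u \<in> borel_measurable borel" for u
  proof -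
    have "sqnorm lborel (\<lambda>w. of_real a * fourier F w * u (a * w)) \<le>
        (\<integral>\<^sup>+w. ennreal ((a * k)\<^sup>2) * ennreal ((cmod (u (a * w)))\<^sup>2) \<partial>lborel)"
      unfolding sqnorm_def
    proof (rule nn_integral_mono)
      fix w
      have "(cmod (of_real a * fourier F w * u (a * w)))\<^sup>2 \<le> (a * k * cmod (u (a * w)))\<^sup>2"
        using a k[of w] by (intro power_mono) (auto simp: norm_mult intro!: mult_right_mono)
      then show "ennreal ((cmod (of_real a * fourier F w * u (a * w)))\<^sup>2)
          \<le> ennreal ((a * k)\<^sup>2) * ennreal ((cmod (u (a * w)))\<^sup>2)"
        by (subst ennreal_mult[symmetric]) (auto intro!: ennreal_leI simp: power_mult_distrib)
    qed
    also have "\<dots> = ennreal ((a * k)\<^sup>2) * sqnorm lborel (\<lambda>w. u (a * w))"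
      by (simp add: nn_integral_cmult sqnorm_def)
    also have "\<dots> = ennreal ((a * k)\<^sup>2 / a) * sqnorm lborel u"
    proof -
      have "sqnorm lborel u = ennreal a * sqnorm lborel (\<lambda>w. u (a * w))"
        using sqnorm_affine[of u a 0] a by simp
      moreover have "ennreal ((a * k)\<^sup>2 / a) * ennreal a = ennreal ((a * k)\<^sup>2)"
        using a by (subst ennreal_mult[symmetric]) auto
      ultimately show ?thesis by (simp add: mult.assoc[symmetric])
    qed
    finally show ?thesis .
  qed
  show "sqnorm lborel (\<lambda>w. of_real a * fourier F w * V (a * w)) < \<infinity>"
    by (rule le_less_trans[OF weight]) (use V_L2 in \<open>auto simp: L2_iff ennreal_mult_less_top\<close>)
  show "(\<lambda>n. sqnorm lborel (\<lambda>w. Y n w - of_real a * fourier F w * V (a * w))) \<longlonglongrightarrow> 0"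
  proof (rule tendsto_sandwich[OF _ _ tendsto_const])
    show "\<forall>\<^sub>F n in sequentially. sqnorm lborel (\<lambda>w. Y n w - of_real a * fourier F w * V (a * w))
        \<le> ennreal ((a * k)\<^sup>2 / a) * sqnorm lborel (\<lambda>w. fourier (truncate v n) w - V w)"
    proof (intro always_eventually allI)
      fix n
      have "(\<lambda>w. Y n w - of_real a * fourier F w * V (a * w)) =
          (\<lambda>w. of_real a * fourier F w * (fourier (truncate v n) (a * w) - V (a * w)))"
        by (simp add: Y_def right_diff_distrib)
      then show "sqnorm lborel (\<lambda>w. Y n w - of_real a * fourier F w * V (a * w))
        \<le> ennreal ((a * k)\<^sup>2 / a) * sqnorm lborel (\<lambda>w. fourier (truncate v n) w - V w)"
        using weight[of "\<lambda>w. fourier (truncate v n) w - V w"] by simp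
    qed
    have "(\<lambda>n. ennreal ((a * k)\<^sup>2 / a) * sqnorm lborel (\<lambda>w. fourier (truncate v n) w - V w))
        \<longlonglongrightarrow> ennreal ((a * k)\<^sup>2 / a) * 0"
      by (intro ennreal_tendsto_cmult V_lim) simp
    then show "(\<lambda>n. ennreal ((a * k)\<^sup>2 / a) * sqnorm lborel (\<lambda>w. fourier (truncate v n) w - V w))
        \<longlonglongrightarrow> 0" by simp
  qed simp
qed simp

section \<open>The Calderon identity\<close>

text \<open>
  Half of the weight \<open>a\<^sup>-\<^sup>3\<close> is absorbed into each coefficient: \<open>a\<^sup>-\<^sup>2\<close> comes from the measure
  \<open>db da / a\<^sup>2\<close> and \<open>a\<^sup>-\<^sup>1\<close> from the normalization of the wavelets. The value \<open>0\<close> for \<open>a \<le> 0\<close> allows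
  integration over the whole plane.
\<close>
definition wavelet_coeff :: "(real \<Rightarrow> complex) \<Rightarrow> (real \<Rightarrow> complex) \<Rightarrow> real \<times> real \<Rightarrow> complex" where
  "wavelet_coeff v F = (\<lambda>(b, a). if 0 < a then dilated_conv F v a b / of_real (sqrt (a ^ 3)) else 0)"

lemma wavelet_coeff_measurable:
  assumes [measurable]: "F \<in> borel_measurable borel" "v \<in> borel_measurable borel"
  shows "wavelet_coeff v F \<in> borel_measurable (lborel \<Otimes>\<^sub>M lborel)"
  unfolding wavelet_coeff_def dilated_conv_def by measurable

lemma L2_reflect_dilate:
  assumes "v \<in> L2" "a \<noteq> 0" shows "(\<lambda>t. v ((b - t) / a)) \<in> L2"
  using L2_affine[OF assms(1), of "- 1 / a" "b / a"] assms(2) by (simp add: diff_divide_distrib)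

lemma dilated_conv_add:
  assumes F: "F \<in> L2" and G: "G \<in> L2" and v: "v \<in> L2" and a: "a > 0"
  shows "dilated_conv (\<lambda>t. F t + c * G t) v a b = dilated_conv F v a b + c * dilated_conv G v a b"
proof -
  have int: "integrable lborel (\<lambda>t. u t * v ((b - t) / a))" if "u \<in> L2" for u
    using that L2_reflect_dilate[OF v, of a b] a
    by (intro integrable_mult_sqnorm) (auto simp: L2_iff)
  show ?thesis
    unfolding dilated_conv_def distrib_right mult.assoc
    by (subst Bochner_Integration.integral_add) (use int[OF F] int[OF G] in auto)
qed

lemma wavelet_coeff_add:
  assumes "F \<in> L2" "G \<in> L2" "v \<in> L2"
  shows "wavelet_coeff v (\<lambda>t. F t + c * G t) = (\<lambda>z. wavelet_coeff v F z + c * wavelet_coeff v G z)"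
  by (auto simp: wavelet_coeff_def dilated_conv_add assms add_divide_distrib)

text \<open>
  In the frequency domain the factors \<open>a\<^sup>-\<^sup>3\<close> and \<open>a\<^sup>2\<close> combine to the weight \<open>1 / a\<close> of the admissibility
  condition, and after Tonelli's theorem the inner integral is the constant \<open>E\<close>.
\<close>
lemma sqnorm_wavelet_coeff_Cc:
  assumes F: "F \<in> Cc" and v: "v \<in> L2" and V: "plancherel_transform v V" and "E \<ge> 0"
    and adm: "AE w in lborel. (\<integral>\<^sup>+a\<in>{0<..}. ennreal (1 / a * (cmod (V (a * w)))\<^sup>2) \<partial>lborel) = ennreal E"
  shows "sqnorm (lborel \<Otimes>\<^sub>M lborel) (wavelet_coeff v F) = ennreal E * sqnorm lborel F"
proof -
  have [measurable]: "F \<in> borel_measurable borel" "v \<in> borel_measurable borel" "V \<in> borel_measurable borel"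
    using Cc_measurable[OF F] L2_measurable[OF v] V
    by (auto simp: plancherel_transform_def intro: L2_measurable)
  note [measurable] = fourier_measurable wavelet_coeff_measurable
  define k where "k a w = ennreal (1 / (2 * pi)) * (ennreal ((cmod (fourier F w))\<^sup>2) *
      (ennreal (1 / a * (cmod (V (a * w)))\<^sup>2) * indicator {0<..} a))" for a w
  have slice: "(\<integral>\<^sup>+b. ennreal ((cmod (wavelet_coeff v F (b, a)))\<^sup>2) \<partial>lborel) =
      (\<integral>\<^sup>+w. k a w \<partial>lborel)" for a
  proof (cases "a > 0")
    case True
    have "(\<integral>\<^sup>+b. ennreal ((cmod (wavelet_coeff v F (b, a)))\<^sup>2) \<partial>lborel) =
        (\<integral>\<^sup>+b. ennreal (1 / a ^ 3) * ennreal ((cmod (dilated_conv F v a b))\<^sup>2) \<partial>lborel)"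
      using True
      by (intro nn_integral_cong) (auto simp: wavelet_coeff_def norm_divide power_divide simp flip: ennreal_mult)
    also have "\<dots> = ennreal (1 / a ^ 3) * sqnorm lborel (dilated_conv F v a)"
      unfolding sqnorm_def dilated_conv_def by (rule nn_integral_cmult) measurable
    also have "\<dots> = ennreal (1 / a ^ 3) * (ennreal (1 / (2 * pi)) *
        sqnorm lborel (\<lambda>w. of_real a * fourier F w * V (a * w)))"
      by (simp only: sqnorm_dilated_conv[OF F v V True])
    also have "\<dots> = (\<integral>\<^sup>+w. ennreal (1 / a ^ 3) * (ennreal (1 / (2 * pi)) *
        ennreal ((cmod (of_real a * fourier F w * V (a * w)))\<^sup>2)) \<partial>lborel)"
      unfolding sqnorm_def by (simp add: nn_integral_cmult)
    also have "\<dots> = (\<integral>\<^sup>+w. k a w \<partial>lborel)"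
      using True unfolding k_def
      by (intro nn_integral_cong)
         (auto simp: norm_mult power_mult_distrib power2_eq_square power3_eq_cube field_simps simp flip: ennreal_mult)
    finally show ?thesis .
  next
    case False
    then show ?thesis by (simp add: wavelet_coeff_def k_def)
  qed
  have "sqnorm (lborel \<Otimes>\<^sub>M lborel) (wavelet_coeff v F) =
      (\<integral>\<^sup>+a. (\<integral>\<^sup>+b. ennreal ((cmod (wavelet_coeff v F (b, a)))\<^sup>2) \<partial>lborel) \<partial>lborel)"
    unfolding sqnorm_def by (rule lborel_pair.nn_integral_snd[symmetric]) measurable
  also have "\<dots> = (\<integral>\<^sup>+a. (\<integral>\<^sup>+w. k a w \<partial>lborel) \<partial>lborel)"
    unfolding slice ..
  also have "\<dots> = (\<integral>\<^sup>+w. (\<integral>\<^sup>+a. k a w \<partial>lborel) \<partial>lborel)"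
    by (rule lborel_pair.Fubini'[symmetric]) (unfold k_def, measurable)
  also have "\<dots> = (\<integral>\<^sup>+w. ennreal (1 / (2 * pi)) * (ennreal ((cmod (fourier F w))\<^sup>2) *
      (\<integral>\<^sup>+a\<in>{0<..}. ennreal (1 / a * (cmod (V (a * w)))\<^sup>2) \<partial>lborel)) \<partial>lborel)"
    unfolding k_def by (simp add: nn_integral_cmult)
  also have "\<dots> = (\<integral>\<^sup>+w. ennreal (1 / (2 * pi)) * (ennreal ((cmod (fourier F w))\<^sup>2) * ennreal E) \<partial>lborel)"
    by (rule nn_integral_cong_AE) (use adm in eventually_elim, simp)
  also have "\<dots> = ennreal (1 / (2 * pi)) * (sqnorm lborel (fourier F) * ennreal E)"
    unfolding sqnorm_def by (simp add: nn_integral_cmult nn_integral_multc)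
  also have "\<dots> = ennreal (1 / (2 * pi)) * ennreal (2 * pi) * (ennreal E * sqnorm lborel F)"
    unfolding plancherel_Cc[OF F] by (simp only: mult_ac)
  also have "ennreal (1 / (2 * pi)) * ennreal (2 * pi) = 1"
    by (simp flip: ennreal_mult)
  finally show ?thesis by simp
qed

text \<open>
  Functions in \<open>Cc\<close> are dense, and for fixed \<open>(b, a)\<close> the coefficient depends continuously on \<open>F\<close> by the
  Cauchy-Schwarz inequality; this is the pointwise convergence that \<open>isometry_limit\<close> asks for.
\<close>
theorem sqnorm_wavelet_coeff:
  assumes F: "F \<in> L2" and v: "v \<in> L2" and V: "plancherel_transform v V" and E: "E \<ge> 0"
    and adm: "AE w in lborel. (\<integral>\<^sup>+a\<in>{0<..}. ennreal (1 / a * (cmod (V (a * w)))\<^sup>2) \<partial>lborel) = ennreal E"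
  shows "sqnorm (lborel \<Otimes>\<^sub>M lborel) (wavelet_coeff v F) = ennreal E * sqnorm lborel F"
proof -
  obtain Fn where Fn: "\<And>n. Fn n \<in> Cc" "(\<lambda>n. sqnorm lborel (\<lambda>x. Fn n x - F x)) \<longlonglongrightarrow> 0"
    using Cc_dense_L2[OF F] by metis
  have [measurable]: "F \<in> borel_measurable borel" "v \<in> borel_measurable borel"
    "\<And>n. Fn n \<in> borel_measurable borel"
    using F v Fn by (auto intro: L2_measurable Cc_measurable)
  note [measurable] = wavelet_coeff_measurable
  have iso: "sqnorm (lborel \<Otimes>\<^sub>M lborel) (wavelet_coeff v G) = ennreal E * sqnorm lborel G" if "G \<in> Cc" for G
    by (rule sqnorm_wavelet_coeff_Cc[OF that v V E adm])
  have conv_lim: "(\<lambda>n. dilated_conv (Fn n) v a b) \<longlonglongrightarrow> dilated_conv F v a b" if a: "a > 0" for a b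
  proof -
    define S where "S = sqnorm lborel (\<lambda>t. v ((b - t) / a))"
    have vab: "(\<lambda>t. v ((b - t) / a)) \<in> L2"
      using L2_reflect_dilate[OF v] a by simp
    then have S: "S < \<infinity>" by (simp add: S_def L2_iff)
    have "(\<lambda>n. ennreal ((cmod (dilated_conv (Fn n) v a b - dilated_conv F v a b))\<^sup>2)) \<longlonglongrightarrow> ennreal 0"
    proof (rule tendsto_sandwich[OF _ _ tendsto_const])
      show "\<forall>\<^sub>F n in sequentially. ennreal ((cmod (dilated_conv (Fn n) v a b - dilated_conv F v a b))\<^sup>2)
          \<le> S * sqnorm lborel (\<lambda>x. Fn n x - F x)"
        using order_tendstoD(2)[OF Fn(2), of \<infinity>, simplified]
      proof eventually_elim
        fix n assume fin: "sqnorm lborel (\<lambda>x. Fn n x - F x) < top"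
        have "dilated_conv (Fn n) v a b - dilated_conv F v a b = dilated_conv (\<lambda>t. Fn n t + (-1) * F t) v a b"
          by (subst dilated_conv_add) (use Cc_subset_L2[OF Fn(1)] F v a in auto)
        also have "\<dots> = (\<integral>t. (Fn n t - F t) * v ((b - t) / a) \<partial>lborel)"
          by (simp add: dilated_conv_def)
        finally show "ennreal ((cmod (dilated_conv (Fn n) v a b - dilated_conv F v a b))\<^sup>2)
          \<le> S * sqnorm lborel (\<lambda>x. Fn n x - F x)"
          using Cauchy_Schwarz_sqnorm[of "\<lambda>t. Fn n t - F t" lborel "\<lambda>t. v ((b - t) / a)"] fin S
          by (simp add: S_def mult.commute)
      qed
      have "(\<lambda>n. S * sqnorm lborel (\<lambda>x. Fn n x - F x)) \<longlonglongrightarrow> S * 0"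
        using S by (intro ennreal_tendsto_cmult Fn(2)) auto
      then show "(\<lambda>n. S * sqnorm lborel (\<lambda>x. Fn n x - F x)) \<longlonglongrightarrow> ennreal 0" by simp
    qed simp
    then have "(\<lambda>n. (cmod (dilated_conv (Fn n) v a b - dilated_conv F v a b))\<^sup>2) \<longlonglongrightarrow> 0"
      by (subst (asm) tendsto_ennreal_iff) auto
    then have "(\<lambda>n. cmod (dilated_conv (Fn n) v a b - dilated_conv F v a b)) \<longlonglongrightarrow> 0"
      using tendsto_real_sqrt by fastforce
    then show ?thesis
      using tendsto_norm_zero_iff Lim_null by blast
  qed
  show ?thesis
  proof (rule isometry_limit)
    show "AE z in lborel \<Otimes>\<^sub>M lborel. (\<lambda>n. wavelet_coeff v (Fn n) z) \<longlonglongrightarrow> wavelet_coeff v F z"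
      by (intro AE_I2) (auto simp: wavelet_coeff_def split: prod.split intro!: tendsto_divide conv_lim)
    show "(\<lambda>n. sqnorm lborel (\<lambda>x. Fn n x - F x)) \<longlonglongrightarrow> 0" by (rule Fn(2))
    show "sqnorm lborel F < \<infinity>" using F by (simp add: L2_iff)
    show "sqnorm (lborel \<Otimes>\<^sub>M lborel) (wavelet_coeff v (Fn n)) = ennreal E * sqnorm lborel (Fn n)" for n
      by (rule iso[OF Fn(1)])
    show "sqnorm (lborel \<Otimes>\<^sub>M lborel) (\<lambda>z. wavelet_coeff v (Fn m) z - wavelet_coeff v (Fn n) z) =
        ennreal E * sqnorm lborel (\<lambda>x. Fn m x - Fn n x)" for m n
      using iso[OF Cc_diff[OF Fn(1) Fn(1)], of m n]
        wavelet_coeff_add[OF Cc_subset_L2[OF Fn(1)] Cc_subset_L2[OF Fn(1)] v, of m "-1" n] by simp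
  qed simp_all
qed

section \<open>Polarization\<close>

lemma polarization_identity:
  fixes X Y :: "'a \<Rightarrow> complex"
  assumes [measurable]: "X \<in> borel_measurable M" "Y \<in> borel_measurable M"
    and fin: "sqnorm M X < \<infinity>" "sqnorm M Y < \<infinity>"
  shows "(\<integral>z. X z * cnj (Y z) \<partial>M) =
    (of_real (enn2real (sqnorm M (\<lambda>z. X z + 1 * Y z))) - of_real (enn2real (sqnorm M (\<lambda>z. X z + (-1) * Y z)))
     + \<i> * of_real (enn2real (sqnorm M (\<lambda>z. X z + \<i> * Y z)))
     - \<i> * of_real (enn2real (sqnorm M (\<lambda>z. X z + (-\<i>) * Y z)))) / 4"
proof -
  define N where "N c z = (cmod (X z + c * Y z))\<^sup>2" for c z
  have [measurable]: "N c \<in> borel_measurable M" for c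
    unfolding N_def[abs_def] by measurable
  have "sqnorm M (\<lambda>z. X z + c * Y z) < \<infinity>" for c
  proof -
    have "sqnorm M (\<lambda>z. X z + c * Y z) \<le> 2 * sqnorm M X + 2 * sqnorm M (\<lambda>z. c * Y z)"
      using sqnorm_le_twice[of "\<lambda>z. X z + c * Y z" M X] by simp
    also have "\<dots> < \<infinity>"
      using fin by (simp add: sqnorm_cmult ennreal_mult_less_top)
    finally show ?thesis .
  qed
  then have int: "integrable M (N c)" for c
    by (simp add: integrable_iff_bounded sqnorm_def N_def[abs_def])
  have val: "enn2real (sqnorm M (\<lambda>z. X z + c * Y z)) = (\<integral>z. N c z \<partial>M)" for c
    unfolding sqnorm_def N_def by (rule integral_eq_nn_integral[symmetric]) auto
  have point: "X z * cnj (Y z) = (of_real (N 1 z) - of_real (N (-1) z) + \<i> * of_real (N \<i> z)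
      - \<i> * of_real (N (-\<i>) z)) / 4" for z
    unfolding N_def complex_norm_square by (simp add: algebra_simps)
  show ?thesis
    unfolding point val using int by simp
qed

lemma polarization_isometry:
  fixes X Y :: "'a \<Rightarrow> complex" and x y :: "'b \<Rightarrow> complex"
  assumes meas: "X \<in> borel_measurable M" "Y \<in> borel_measurable M" "x \<in> borel_measurable N" "y \<in> borel_measurable N"
    and fin: "sqnorm M X < \<infinity>" "sqnorm M Y < \<infinity>" "sqnorm N x < \<infinity>" "sqnorm N y < \<infinity>"
    and "E \<ge> 0"
    and iso: "\<And>c. sqnorm M (\<lambda>z. X z + c * Y z) = ennreal E * sqnorm N (\<lambda>t. x t + c * y t)"
  shows "(\<integral>z. X z * cnj (Y z) \<partial>M) = of_real E * (\<integral>t. x t * cnj (y t) \<partial>N)"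
  unfolding polarization_identity[OF meas(1,2) fin(1,2)] polarization_identity[OF meas(3,4) fin(3,4)] iso
  using \<open>E \<ge> 0\<close> by (simp add: enn2real_mult algebra_simps)

section \<open>Reduction of the special affine transforms to Fourier analysis\<close>

definition reflect_cnj :: "(real \<Rightarrow> complex) \<Rightarrow> real \<Rightarrow> complex" where
  "reflect_cnj \<psi> z = cnj (\<psi> (- z))"

lemma L2_reflect_cnj: "\<psi> \<in> L2 \<Longrightarrow> reflect_cnj \<psi> \<in> L2"
proof -
  assume "\<psi> \<in> L2"
  then have *: "(\<lambda>x. \<psi> (- x)) \<in> L2" using L2_affine[of \<psi> "-1" 0] by simp
  then have [measurable]: "(\<lambda>x. \<psi> (- x)) \<in> borel_measurable borel" by (rule L2_measurable)
  have "reflect_cnj \<psi> \<in> borel_measurable borel"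
    unfolding reflect_cnj_def[abs_def] by measurable
  moreover have "sqnorm lborel (reflect_cnj \<psi>) = sqnorm lborel (\<lambda>x. \<psi> (- x))"
    by (rule sqnorm_cong) (simp add: reflect_cnj_def)
  ultimately show ?thesis using * by (simp add: L2_iff)
qed

text \<open>
  The part of the kernel that does not depend on the variable of integration.
\<close>
definition saft_prefactor :: "saft_params \<Rightarrow> real \<Rightarrow> complex" where
  "saft_prefactor = (\<lambda>(A, B, C, D, p, q) \<omega>. 1 / csqrt (\<i> * of_real (2 * pi * B)) *
     cis ((D * (\<omega>\<^sup>2 + p\<^sup>2) - 2 * \<omega> * (D * p - B * q)) / (2 * B)))"

lemma norm_csqrt_squared: "(cmod (csqrt z))\<^sup>2 = cmod z"
  by (metis norm_power power2_csqrt)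

lemma norm_saft_prefactor:
  "(cmod (saft_prefactor (A, B, C, D, p, q) \<omega>))\<^sup>2 = 1 / (2 * pi * \<bar>B\<bar>)"
  by (simp add: saft_prefactor_def norm_mult norm_divide power_divide norm_csqrt_squared abs_mult)

lemma saft_prefactor_measurable: "saft_prefactor M \<in> borel_measurable borel"
  unfolding saft_prefactor_def by (cases M) (simp, measurable)

lemma exp_i_over_eq_cis: "exp (\<i> / of_real r * of_real s) = cis (s / r)"
  by (simp add: cis_conv_exp)

lemma exp_minus_i_over_eq_cis: "exp (- (\<i> / of_real r) * of_real s) = cis (- s / r)"
  by (simp add: cis_conv_exp)

text \<open>
  The chirp in the argument cancels the one in the kernel, and the modulation \<open>2 * z * p * (a - 1)\<close>
  replaces the frequency shift \<open>p\<close> by \<open>p * a\<close>. The shift therefore scales along with \<open>\<omega>\<close> when the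
  transform is evaluated at \<open>a * \<omega>\<close>.
\<close>
lemma truncated_saft_admissibility_arg:
  assumes "B \<noteq> 0"
  shows "(LINT t:{- real n..real n}|lborel.
      admissibility_arg (A, B, C, D, p, q) \<psi> a t * saft_kernel (A, B, C, D, p, q) t \<omega>) =
    saft_prefactor (A, B, C, D, p, q) \<omega> * fourier (truncate (reflect_cnj \<psi>) n) ((\<omega> - p * a) / B)"
proof -
  define \<gamma> where "\<gamma> = 1 / csqrt (\<i> * of_real (2 * pi * B))"
  define \<theta> where "\<theta> = (D * (\<omega>\<^sup>2 + p\<^sup>2) - 2 * \<omega> * (D * p - B * q)) / (2 * B)"
  have phase: "cis ((2 * t * p * (a - 1) - A * t\<^sup>2) / (2 * B)) *
      cis ((A * t\<^sup>2 + 2 * t * (p - \<omega>) - 2 * \<omega> * (D * p - B * q) + D * (\<omega>\<^sup>2 + p\<^sup>2)) / (2 * B)) =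
      cis \<theta> * cis (- ((\<omega> - p * a) / B * t))" for t
    unfolding cis_mult \<theta>_def
    by (rule arg_cong[where f = cis]) (use assms in \<open>simp add: field_simps power2_eq_square\<close>)
  have "indicator {- real n..real n} t *\<^sub>R
      (admissibility_arg (A, B, C, D, p, q) \<psi> a t * saft_kernel (A, B, C, D, p, q) t \<omega>) =
      \<gamma> * cis \<theta> * (truncate (reflect_cnj \<psi>) n t * cis (- ((\<omega> - p * a) / B * t)))" (is "?l = _") for t
  proof -
    have "?l = indicator {- real n..real n} t *\<^sub>R
      (cis ((2 * t * p * (a - 1) - A * t\<^sup>2) / (2 * B)) * cnj (\<psi> (- t)) *
       (\<gamma> * cis ((A * t\<^sup>2 + 2 * t * (p - \<omega>) - 2 * \<omega> * (D * p - B * q) + D * (\<omega>\<^sup>2 + p\<^sup>2)) / (2 * B))))"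
      by (simp only: admissibility_arg.simps saft_kernel.simps exp_i_over_eq_cis \<gamma>_def)
    also have "\<dots> = indicator {- real n..real n} t *\<^sub>R (\<gamma> * cnj (\<psi> (- t)) *
      (cis ((2 * t * p * (a - 1) - A * t\<^sup>2) / (2 * B)) *
       cis ((A * t\<^sup>2 + 2 * t * (p - \<omega>) - 2 * \<omega> * (D * p - B * q) + D * (\<omega>\<^sup>2 + p\<^sup>2)) / (2 * B))))"
      by (simp only: mult_ac)
    also have "\<dots> = \<gamma> * cis \<theta> * (truncate (reflect_cnj \<psi>) n t * cis (- ((\<omega> - p * a) / B * t)))"
      unfolding phase by (simp add: truncate_def reflect_cnj_def scaleR_conv_of_real mult_ac)
    finally show ?thesis .
  qed
  then show ?thesis
    unfolding set_lebesgue_integral_def fourier_def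
    by (simp add: saft_prefactor_def \<gamma>_def \<theta>_def)
qed

lemma sqnorm_limit_AE_unique:
  assumes [measurable]: "\<And>n. X n \<in> borel_measurable M" "Y \<in> borel_measurable M" "Z \<in> borel_measurable M"
    and lim: "(\<lambda>n::nat. sqnorm M (\<lambda>x. X n x - Y x)) \<longlonglongrightarrow> 0" "(\<lambda>n. sqnorm M (\<lambda>x. X n x - Z x)) \<longlonglongrightarrow> 0"
  shows "AE x in M. Y x = Z x"
proof (rule sqnorm_eq_0_imp_AE_eq)
  have "(\<lambda>n. 2 * sqnorm M (\<lambda>x. X n x - Y x) + 2 * sqnorm M (\<lambda>x. X n x - Z x)) \<longlonglongrightarrow> 2 * 0 + 2 * 0"
    by (intro tendsto_add ennreal_tendsto_cmult lim) auto
  moreover have "sqnorm M (\<lambda>x. Y x - Z x) \<le>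
      2 * sqnorm M (\<lambda>x. X n x - Y x) + 2 * sqnorm M (\<lambda>x. X n x - Z x)" for n
    using sqnorm_triangle[of Y M Z "X n"]
    by (simp add: sqnorm_minus_commute[of M Y "X n"] sqnorm_minus_commute[of M Z "X n"])
  ultimately have "sqnorm M (\<lambda>x. Y x - Z x) \<le> 2 * 0 + 2 * 0"
    by (intro LIMSEQ_le_const) auto
  then show "sqnorm M (\<lambda>x. Y x - Z x) = 0" by simp
qed simp_all

text \<open>
  The truncated transforms on both sides differ by an affine substitution and by a prefactor of constant
  modulus, hence so do their limits. From right to left this identifies the transform for a given \<open>a\<close>;
  from left to right, with \<open>a = 1\<close>, it is where the transform of the reflected wavelet comes from.
\<close>
lemma is_saft_admissibility_arg_iff:
  fixes A B C D p q :: real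
  defines "M \<equiv> (A, B, C, D, p, q)"
  assumes "B \<noteq> 0" "\<psi> \<in> L2" "V \<in> borel_measurable borel" "\<Phi> \<in> borel_measurable borel"
    and \<Phi>: "\<And>\<omega>. \<Phi> \<omega> = saft_prefactor M \<omega> * V ((\<omega> - p * a) / B)"
  shows "is_saft M (admissibility_arg M \<psi> a) \<Phi> \<longleftrightarrow> plancherel_transform (reflect_cnj \<psi>) V"
proof -
  have v: "reflect_cnj \<psi> \<in> L2" by (rule L2_reflect_cnj) fact
  have [measurable]: "reflect_cnj \<psi> \<in> borel_measurable borel" "V \<in> borel_measurable borel"
    "\<Phi> \<in> borel_measurable borel"
    using v assms by (auto intro: L2_measurable)
  note [measurable] = fourier_measurable
  have pre: "sqnorm lborel (\<lambda>\<omega>. saft_prefactor M \<omega> * u ((\<omega> - p * a) / B)) =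
      ennreal (1 / (2 * pi)) * sqnorm lborel u" if [measurable]: "u \<in> borel_measurable borel" for u
  proof -
    have "sqnorm lborel (\<lambda>\<omega>. saft_prefactor M \<omega> * u ((\<omega> - p * a) / B)) =
        (\<integral>\<^sup>+\<omega>. ennreal (1 / (2 * pi * \<bar>B\<bar>)) * ennreal ((cmod (u ((\<omega> - p * a) / B)))\<^sup>2) \<partial>lborel)"
      unfolding sqnorm_def norm_mult power_mult_distrib M_def norm_saft_prefactor
      by (simp flip: ennreal_mult)
    also have "\<dots> = ennreal (1 / (2 * pi * \<bar>B\<bar>)) * sqnorm lborel (\<lambda>\<omega>. u ((\<omega> - p * a) / B))"
      unfolding sqnorm_def by (simp add: nn_integral_cmult)
    also have "sqnorm lborel (\<lambda>\<omega>. u ((\<omega> - p * a) / B)) = ennreal \<bar>B\<bar> * sqnorm lborel u"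
      using sqnorm_affine[of "\<lambda>\<omega>. u ((\<omega> - p * a) / B)" B "p * a"] \<open>B \<noteq> 0\<close> by simp
    also have "ennreal (1 / (2 * pi * \<bar>B\<bar>)) * (ennreal \<bar>B\<bar> * sqnorm lborel u) =
        ennreal (1 / (2 * pi)) * sqnorm lborel u"
      using \<open>B \<noteq> 0\<close> by (simp add: mult.assoc[symmetric] flip: ennreal_mult)
    finally show ?thesis .
  qed
  have inv: "ennreal (2 * pi) * (ennreal (1 / (2 * pi)) * s) = s" for s
    by (simp add: mult.assoc[symmetric] flip: ennreal_mult)
  have norm_\<Phi>: "sqnorm lborel \<Phi> = ennreal (1 / (2 * pi)) * sqnorm lborel V"
    unfolding pre[symmetric, OF \<open>V \<in> borel_measurable borel\<close>] \<Phi>[symmetric] ..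
  have "sqnorm lborel \<Phi> < \<infinity> \<longleftrightarrow> sqnorm lborel V < \<infinity>"
    unfolding norm_\<Phi> by (auto simp: ennreal_mult_less_top)
  then have L2: "\<Phi> \<in> L2 \<longleftrightarrow> V \<in> L2"
    using assms by (simp add: L2_iff)
  define e where "e n = sqnorm lborel (\<lambda>w. fourier (truncate (reflect_cnj \<psi>) n) w - V w)" for n
  have "(\<integral>\<^sup>+\<omega>. ennreal ((norm (\<Phi> \<omega> -
      (LINT t:{- real n..real n}|lborel. admissibility_arg M \<psi> a t * saft_kernel M t \<omega>)))\<^sup>2) \<partial>lborel)
      = ennreal (1 / (2 * pi)) * e n" for n
  proof -
    have "\<Phi> \<omega> - (LINT t:{- real n..real n}|lborel. admissibility_arg M \<psi> a t * saft_kernel M t \<omega>) =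
        saft_prefactor M \<omega> * (V ((\<omega> - p * a) / B) -
          fourier (truncate (reflect_cnj \<psi>) n) ((\<omega> - p * a) / B))" for \<omega>
      unfolding M_def truncated_saft_admissibility_arg[OF \<open>B \<noteq> 0\<close>] \<Phi> by (simp add: M_def right_diff_distrib)
    then show ?thesis
      using pre[of "\<lambda>w. V w - fourier (truncate (reflect_cnj \<psi>) n) w"]
      by (simp add: sqnorm_def[symmetric] e_def sqnorm_minus_commute[of lborel V])
  qed
  then have "is_saft M (admissibility_arg M \<psi> a) \<Phi> \<longleftrightarrow>
      V \<in> L2 \<and> (\<lambda>n. ennreal (1 / (2 * pi)) * e n) \<longlonglongrightarrow> 0"
    unfolding is_saft_def L2 by simp
  also have "(\<lambda>n. ennreal (1 / (2 * pi)) * e n) \<longlonglongrightarrow> 0 \<longleftrightarrow> e \<longlonglongrightarrow> 0"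
  proof
    assume "(\<lambda>n. ennreal (1 / (2 * pi)) * e n) \<longlonglongrightarrow> 0"
    from ennreal_tendsto_cmult[OF _ this, of "ennreal (2 * pi)"] show "e \<longlonglongrightarrow> 0"
      by (simp add: inv)
  next
    assume "e \<longlonglongrightarrow> 0"
    from ennreal_tendsto_cmult[OF _ this, of "ennreal (1 / (2 * pi))"]
    show "(\<lambda>n. ennreal (1 / (2 * pi)) * e n) \<longlonglongrightarrow> 0" by simp
  qed
  finally show ?thesis
    by (simp add: plancherel_transform_def e_def[abs_def])
qed

text \<open>
  The substitution \<open>\<omega> = p + B * w\<close> turns \<open>(a * \<omega> - p * a) / B\<close> into \<open>a * w\<close>. For each \<open>a\<close> the modulus of
  the given representative agrees with that of \<open>V\<close> only up to a null set of \<open>w\<close> which depends on \<open>a\<close>;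
  joint measurability allows the two quantifiers to be exchanged.
\<close>
lemma admissible_imp_calderon:
  fixes A B C D p q K :: real
  defines "M \<equiv> (A, B, C, D, p, q)"
  assumes B: "B \<noteq> 0" and \<psi>: "\<psi> \<in> L2" and adm: "admissible_with M \<psi> K"
  obtains V where "plancherel_transform (reflect_cnj \<psi>) V"
    "AE w in lborel. (\<integral>\<^sup>+a\<in>{0<..}. ennreal (1 / a * (cmod (V (a * w)))\<^sup>2) \<partial>lborel)
      = ennreal (2 * pi * \<bar>B\<bar> * K)"
proof -
  obtain \<Phi>' where \<Phi>'_meas: "(\<lambda>(a, \<omega>). \<Phi>' a \<omega>) \<in> borel_measurable (lborel \<Otimes>\<^sub>M lborel)"
    and saft': "\<And>a. a > 0 \<Longrightarrow> is_saft M (admissibility_arg M \<psi> a) (\<Phi>' a)"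
    and const'': "AE \<omega> in lborel.
      (\<integral>\<^sup>+a\<in>{0<..}. ennreal (1 / a * (norm (\<Phi>' a (a * \<omega>)))\<^sup>2) \<partial>lborel) = ennreal K"
    and K: "K \<ge> 0"
    using adm unfolding admissible_with_def by blast
  define \<Phi> where "\<Phi> = (\<lambda>(a, \<omega>). \<Phi>' a \<omega>)"
  have [measurable]: "\<Phi> \<in> borel_measurable (borel \<Otimes>\<^sub>M borel)"
    using \<Phi>'_meas unfolding \<Phi>_def[symmetric]
    by (subst measurable_cong_sets[where M' = "lborel \<Otimes>\<^sub>M lborel" and N' = borel])
       (auto intro!: sets_pair_measure_cong)
  have saft: "is_saft M (admissibility_arg M \<psi> a) (\<lambda>\<omega>. \<Phi> (a, \<omega>))" if "a > 0" for a
    using saft'[OF that] by (simp add: \<Phi>_def)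
  have const: "AE \<omega> in lborel.
      (\<integral>\<^sup>+a\<in>{0<..}. ennreal (1 / a * (norm (\<Phi> (a, a * \<omega>)))\<^sup>2) \<partial>lborel) = ennreal K"
    using const'' by (simp add: \<Phi>_def)
  note [measurable] = saft_prefactor_measurable fourier_measurable
  have v: "reflect_cnj \<psi> \<in> L2" by (rule L2_reflect_cnj[OF \<psi>])
  have [measurable]: "reflect_cnj \<psi> \<in> borel_measurable borel" by (rule L2_measurable[OF v])
  have pre_nz: "saft_prefactor M \<omega> \<noteq> 0" for \<omega>
    using norm_saft_prefactor[of A B C D p q \<omega>] B by (auto simp: M_def)
  (* The special affine transform for a = 1, transported to the frequency variable of the
     Fourier transform. *)
  define V where "V w = \<Phi> (1, B * w + p) / saft_prefactor M (B * w + p)" for w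
  have [measurable]: "V \<in> borel_measurable borel"
    unfolding V_def[abs_def] by measurable
  have "is_saft M (admissibility_arg M \<psi> 1) (\<lambda>\<omega>. \<Phi> (1, \<omega>)) \<longleftrightarrow> plancherel_transform (reflect_cnj \<psi>) V"
    unfolding M_def
  proof (rule is_saft_admissibility_arg_iff[OF B \<psi>])
    show "\<Phi> (1, \<omega>) = saft_prefactor (A, B, C, D, p, q) \<omega> * V ((\<omega> - p * 1) / B)" for \<omega>
      using B pre_nz[of \<omega>] by (simp add: V_def M_def)
  qed measurable
  then have V: "plancherel_transform (reflect_cnj \<psi>) V"
    using saft[of 1] by simp
  have modulus: "AE w in lborel. (cmod (\<Phi> (a, a * (p + B * w))))\<^sup>2 = 1 / (2 * pi * \<bar>B\<bar>) * (cmod (V (a * w)))\<^sup>2"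
    if a: "a > 0" for a
  proof -
    define \<Psi> where "\<Psi> \<omega> = saft_prefactor M \<omega> * V ((\<omega> - p * a) / B)" for \<omega>
    have [measurable]: "\<Psi> \<in> borel_measurable borel"
      unfolding \<Psi>_def[abs_def] by measurable
    have saft_\<Psi>: "is_saft M (admissibility_arg M \<psi> a) \<Psi>"
      unfolding M_def
      by (rule is_saft_admissibility_arg_iff[THEN iffD2, OF B \<psi> _ _ _ V]) (simp_all add: \<Psi>_def M_def)
    define T where "T n \<omega> = (LINT t:{- real n..real n}|lborel. admissibility_arg M \<psi> a t * saft_kernel M t \<omega>)" for n \<omega>
    have "T n = (\<lambda>\<omega>. saft_prefactor M \<omega> * fourier (truncate (reflect_cnj \<psi>) n) ((\<omega> - p * a) / B))" for n
      unfolding T_def[abs_def] M_def by (rule ext) (rule truncated_saft_admissibility_arg[OF B])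
    then have [measurable]: "T n \<in> borel_measurable borel" for n
      by simp
    have "AE \<omega> in lborel. \<Phi> (a, \<omega>) = \<Psi> \<omega>"
    proof (rule sqnorm_limit_AE_unique)
      show "(\<lambda>n. sqnorm lborel (\<lambda>\<omega>. T n \<omega> - \<Phi> (a, \<omega>))) \<longlonglongrightarrow> 0"
        using saft[OF a] unfolding sqnorm_minus_commute[of _ "T _"]
        by (simp add: is_saft_def sqnorm_def T_def)
      show "(\<lambda>n. sqnorm lborel (\<lambda>\<omega>. T n \<omega> - \<Psi> \<omega>)) \<longlonglongrightarrow> 0"
        using saft_\<Psi> unfolding sqnorm_minus_commute[of _ "T _"]
        by (simp add: is_saft_def sqnorm_def T_def)
    qed measurable
    then have "AE w in lborel. \<Phi> (a, a * p + a * B * w) = \<Psi> (a * p + a * B * w)"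
      using a B by (intro AE_borel_affine) auto
    then show ?thesis
    proof eventually_elim
      case (elim w)
      have "\<Phi> (a, a * (p + B * w)) = \<Psi> (a * p + a * B * w)"
        using elim by (simp add: algebra_simps)
      also have "\<dots> = saft_prefactor M (a * p + a * B * w) * V (a * w)"
        using B by (simp add: \<Psi>_def mult.commute)
      finally show ?case
        by (simp only: norm_mult power_mult_distrib M_def norm_saft_prefactor)
    qed
  qed
  have "AE a in lborel. AE w in lborel. a > 0 \<longrightarrow>
      (cmod (\<Phi> (a, a * (p + B * w))))\<^sup>2 = 1 / (2 * pi * \<bar>B\<bar>) * (cmod (V (a * w)))\<^sup>2"
  proof (rule AE_I2)
    fix a
    show "AE w in lborel. a > 0 \<longrightarrow>
      (cmod (\<Phi> (a, a * (p + B * w))))\<^sup>2 = 1 / (2 * pi * \<bar>B\<bar>) * (cmod (V (a * w)))\<^sup>2"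
      using modulus[of a] by (cases "a > 0") auto
  qed
  then have swap: "AE w in lborel. AE a in lborel. a > 0 \<longrightarrow>
      (cmod (\<Phi> (a, a * (p + B * w))))\<^sup>2 = 1 / (2 * pi * \<bar>B\<bar>) * (cmod (V (a * w)))\<^sup>2"
    by (subst (asm) lborel_pair.AE_commute) measurable
  have const': "AE w in lborel.
      (\<integral>\<^sup>+a\<in>{0<..}. ennreal (1 / a * (norm (\<Phi> (a, a * (p + B * w))))\<^sup>2) \<partial>lborel) = ennreal K"
    by (rule AE_borel_affine[OF B _ const]) measurable
  have "AE w in lborel. (\<integral>\<^sup>+a\<in>{0<..}. ennreal (1 / a * (cmod (V (a * w)))\<^sup>2) \<partial>lborel)
      = ennreal (2 * pi * \<bar>B\<bar> * K)"
    using swap const'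
  proof eventually_elim
    case (elim w)
    have "(\<integral>\<^sup>+a\<in>{0<..}. ennreal (1 / a * (cmod (V (a * w)))\<^sup>2) \<partial>lborel) =
        (\<integral>\<^sup>+a. ennreal (2 * pi * \<bar>B\<bar>) *
          (ennreal (1 / a * (norm (\<Phi> (a, a * (p + B * w))))\<^sup>2) * indicator {0<..} a) \<partial>lborel)"
    proof (rule nn_integral_cong_AE, use elim(1) in eventually_elim)
      fix a
      assume "a > 0 \<longrightarrow> (cmod (\<Phi> (a, a * (p + B * w))))\<^sup>2 = 1 / (2 * pi * \<bar>B\<bar>) * (cmod (V (a * w)))\<^sup>2"
      then show "ennreal (1 / a * (cmod (V (a * w)))\<^sup>2) * indicator {0<..} a = ennreal (2 * pi * \<bar>B\<bar>) *
          (ennreal (1 / a * (norm (\<Phi> (a, a * (p + B * w))))\<^sup>2) * indicator {0<..} a)"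
        using B by (auto simp: indicator_def simp flip: ennreal_mult)
    qed
    also have "\<dots> = ennreal (2 * pi * \<bar>B\<bar>) * ennreal K"
      unfolding elim(2)[symmetric] by (rule nn_integral_cmult) measurable
    also have "\<dots> = ennreal (2 * pi * \<bar>B\<bar> * K)"
      using K by (simp add: ennreal_mult)
    finally show ?case .
  qed
  with V that show ?thesis by blast
qed

definition chirp :: "saft_params \<Rightarrow> (real \<Rightarrow> complex) \<Rightarrow> real \<Rightarrow> complex" where
  "chirp = (\<lambda>(A, B, C, D, p, q) f t. f t * cis (A * t\<^sup>2 / (2 * B)))"

lemma chirp_isometry:
  "cmod (chirp M f t) = cmod (f t)" "chirp M f t * cnj (chirp M g t) = f t * cnj (g t)"
  by (cases M; simp add: chirp_def norm_mult cis_cnj cis_mult mult_ac)+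

lemma L2_chirp: assumes "f \<in> L2" shows "chirp M f \<in> L2"
proof -
  have [measurable]: "f \<in> borel_measurable borel" by (rule L2_measurable[OF assms])
  have "chirp M f \<in> borel_measurable borel"
    unfolding chirp_def by (cases M) (simp, measurable)
  moreover have "sqnorm lborel (chirp M f) = sqnorm lborel f"
    by (rule sqnorm_cong) (rule chirp_isometry)
  ultimately show ?thesis using assms by (simp add: L2_iff)
qed

lemma L2_add:
  assumes "f \<in> L2" "g \<in> L2" shows "(\<lambda>t. f t + c * g t) \<in> L2"
proof -
  have [measurable]: "f \<in> borel_measurable borel" "g \<in> borel_measurable borel"
    using assms by (auto intro: L2_measurable)
  have "sqnorm lborel (\<lambda>t. f t + c * g t) \<le> 2 * sqnorm lborel f + 2 * sqnorm lborel (\<lambda>t. c * g t)"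
    using sqnorm_le_twice[of "\<lambda>t. f t + c * g t" lborel f] by simp
  also have "\<dots> < \<infinity>"
    using assms by (simp add: sqnorm_cmult L2_iff ennreal_mult_less_top)
  finally show ?thesis by (simp add: L2_iff)
qed

text \<open>
  Of the phase of the wavelet only \<open>A * t\<^sup>2\<close> depends on \<open>t\<close>; it is moved into the signal. The rest is a
  factor common to all signals.
\<close>
lemma sa_wavelet_transform_eq_dilated_conv:
  fixes A B C D p q :: real
  defines "M \<equiv> (A, B, C, D, p, q)"
  shows "sa_wavelet_transform M \<psi> f b a =
    cnj (1 / csqrt (\<i> * of_real (2 * pi * a * B))) * cis ((D * p\<^sup>2 - A * (b / a)\<^sup>2) / (2 * B)) *
      dilated_conv (chirp M f) (reflect_cnj \<psi>) a b"
proof -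
  define \<gamma> where "\<gamma> = cnj (1 / csqrt (\<i> * of_real (2 * pi * a * B)))"
  define \<theta> where "\<theta> = (D * p\<^sup>2 - A * (b / a)\<^sup>2) / (2 * B)"
  have "f t * cnj (sa_wavelet M \<psi> b a t) =
      \<gamma> * cis \<theta> * (chirp M f t * reflect_cnj \<psi> ((b - t) / a))" for t
  proof -
    have 1: "exp (- (\<i> / of_real (2 * B)) * of_real (A * t\<^sup>2 + D * p\<^sup>2 - A * (b / a)\<^sup>2)) =
        cnj (cis \<theta> * cis (A * t\<^sup>2 / (2 * B)))"
    proof -
      have "exp (- (\<i> / of_real (2 * B)) * of_real (A * t\<^sup>2 + D * p\<^sup>2 - A * (b / a)\<^sup>2)) =
          cis (- (A * t\<^sup>2 + D * p\<^sup>2 - A * (b / a)\<^sup>2) / (2 * B))"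
        by (rule exp_minus_i_over_eq_cis)
      also have "- (A * t\<^sup>2 + D * p\<^sup>2 - A * (b / a)\<^sup>2) / (2 * B) = - (\<theta> + A * t\<^sup>2 / (2 * B))"
        unfolding \<theta>_def add_divide_distrib[symmetric] minus_divide_left
        by (rule arg_cong[where f = "\<lambda>x. x / (2 * B)"]) simp
      finally show ?thesis
        by (simp add: cis_mult cis_cnj)
    qed
    have 2: "- ((b - t) / a) = (t - b) / a" by (simp add: diff_divide_distrib)
    have "sa_wavelet M \<psi> b a t = 1 / csqrt (\<i> * of_real (2 * pi * a * B)) *
        \<psi> ((t - b) / a) * cnj (cis \<theta> * cis (A * t\<^sup>2 / (2 * B)))"
      by (simp only: M_def sa_wavelet.simps 1)
    then have "cnj (sa_wavelet M \<psi> b a t) =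
        \<gamma> * cnj (\<psi> ((t - b) / a)) * (cis \<theta> * cis (A * t\<^sup>2 / (2 * B)))"
      by (simp only: \<gamma>_def complex_cnj_mult complex_cnj_cnj)
    then show ?thesis
      by (simp only: chirp_def M_def prod.case reflect_cnj_def 2 mult_ac)
  qed
  then show ?thesis
    unfolding sa_wavelet_transform_def dilated_conv_def \<gamma>_def \<theta>_def by simp
qed

section \<open>The Moyal identity\<close>

theorem theorem3p3:
  fixes A B C D p q C\<^sub>\<psi> :: real
    and M :: saft_params
    and \<psi> f g :: "real \<Rightarrow> complex"
  assumes "A * D - B * C = 1"
    and "B \<noteq> 0"
    and "M = (A, B, C, D, p, q)"
    and "\<psi> \<in> L2"
    and "f \<in> L2"
    and "g \<in> L2"
    and "admissible_with M \<psi> C\<^sub>\<psi>"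
  shows "set_integrable (lborel \<Otimes>\<^sub>M lborel) (UNIV \<times> {0<..})
           (\<lambda>(b, a). sa_wavelet_transform M \<psi> f b a * cnj (sa_wavelet_transform M \<psi> g b a) /
              of_real (a\<^sup>2)) \<and>
         (LINT (b, a):UNIV \<times> {0<..}|lborel \<Otimes>\<^sub>M lborel.
            sa_wavelet_transform M \<psi> f b a * cnj (sa_wavelet_transform M \<psi> g b a) /
              of_real (a\<^sup>2))
         = of_real C\<^sub>\<psi> * L2_inner f g"
proof -
  define E where "E = 2 * pi * \<bar>B\<bar> * C\<^sub>\<psi>"
  define v where "v = reflect_cnj \<psi>"
  define X where "X h = wavelet_coeff v (chirp M h)" for h
  have E: "E \<ge> 0"
    using assms(7) by (simp add: E_def admissible_with_def)
  have adm: "admissible_with (A, B, C, D, p, q) \<psi> C\<^sub>\<psi>"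
    using assms(7) unfolding assms(3) .
  obtain V where V: "plancherel_transform v V"
    "AE w in lborel. (\<integral>\<^sup>+a\<in>{0<..}. ennreal (1 / a * (cmod (V (a * w)))\<^sup>2) \<partial>lborel) = ennreal E"
    unfolding v_def E_def by (rule admissible_imp_calderon[OF assms(2,4) adm])
  have v: "v \<in> L2" unfolding v_def by (rule L2_reflect_cnj) fact
  have F: "chirp M f \<in> L2" and G: "chirp M g \<in> L2"
    by (rule L2_chirp, fact)+
  have X_meas: "X f \<in> borel_measurable (lborel \<Otimes>\<^sub>M lborel)" "X g \<in> borel_measurable (lborel \<Otimes>\<^sub>M lborel)"
    unfolding X_def using F G v by (auto intro: wavelet_coeff_measurable L2_measurable)
  have iso: "sqnorm (lborel \<Otimes>\<^sub>M lborel) (wavelet_coeff v H) = ennreal E * sqnorm lborel H" if "H \<in> L2" for H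
    by (rule sqnorm_wavelet_coeff[OF that v V(1) E V(2)])
  have X_fin: "sqnorm (lborel \<Otimes>\<^sub>M lborel) (X f) < \<infinity>" "sqnorm (lborel \<Otimes>\<^sub>M lborel) (X g) < \<infinity>"
    unfolding X_def iso[OF F] iso[OF G] using F G by (auto simp: L2_iff ennreal_mult_less_top)
  have cnj_X: "(\<lambda>z. cnj (X g z)) \<in> borel_measurable (lborel \<Otimes>\<^sub>M lborel)"
    using X_meas by measurable
  have int: "integrable (lborel \<Otimes>\<^sub>M lborel) (\<lambda>z. X f z * cnj (X g z))"
  proof (rule integrable_mult_sqnorm[OF X_meas(1) cnj_X X_fin(1)])
    have "sqnorm (lborel \<Otimes>\<^sub>M lborel) (\<lambda>z. cnj (X g z)) = sqnorm (lborel \<Otimes>\<^sub>M lborel) (X g)"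
      by (rule sqnorm_cong) (rule complex_mod_cnj)
    then show "sqnorm (lborel \<Otimes>\<^sub>M lborel) (\<lambda>z. cnj (X g z)) < \<infinity>"
      using X_fin(2) by (simp only:)
  qed
  have val: "(\<integral>z. X f z * cnj (X g z) \<partial>(lborel \<Otimes>\<^sub>M lborel)) =
      of_real E * (\<integral>t. chirp M f t * cnj (chirp M g t) \<partial>lborel)"
  proof (rule polarization_isometry)
    show "sqnorm (lborel \<Otimes>\<^sub>M lborel) (\<lambda>z. X f z + c * X g z) =
        ennreal E * sqnorm lborel (\<lambda>t. chirp M f t + c * chirp M g t)" for c
      unfolding X_def wavelet_coeff_add[OF F G v, symmetric] by (rule iso[OF L2_add[OF F G]])
  qed (use X_meas X_fin F G E in \<open>auto simp: L2_iff\<close>)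
  have factor: "indicator (UNIV \<times> {0<..}) z *\<^sub>R (case z of (b, a) \<Rightarrow>
        sa_wavelet_transform M \<psi> f b a * cnj (sa_wavelet_transform M \<psi> g b a) / of_real (a\<^sup>2)) =
      of_real (1 / (2 * pi * \<bar>B\<bar>)) * (X f z * cnj (X g z))" for z
  proof (cases z)
    case (Pair b a)
    show ?thesis
    proof (cases "a > 0")
      case True
      define \<tau> where "\<tau> = cnj (1 / csqrt (\<i> * of_real (2 * pi * a * B))) *
        cis ((D * p\<^sup>2 - A * (b / a)\<^sup>2) / (2 * B))"
      have \<tau>: "\<tau> * cnj \<tau> = of_real (1 / (2 * pi * a * \<bar>B\<bar>))"
        unfolding complex_norm_square[symmetric] \<tau>_def using True
        by (simp add: norm_mult norm_divide power_divide norm_csqrt_squared abs_mult)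
      have W: "sa_wavelet_transform M \<psi> h b a = \<tau> * dilated_conv (chirp M h) v a b" for h
        unfolding assms(3) \<tau>_def v_def by (rule sa_wavelet_transform_eq_dilated_conv)
      have X: "X h z = dilated_conv (chirp M h) v a b / of_real (sqrt (a ^ 3))" for h
        using True by (simp add: X_def wavelet_coeff_def Pair)
      have root: "complex_of_real (sqrt (a ^ 3)) * of_real (sqrt (a ^ 3)) = of_real (a ^ 3)"
        using True by (simp flip: of_real_mult)
      have "sa_wavelet_transform M \<psi> f b a * cnj (sa_wavelet_transform M \<psi> g b a) / of_real (a\<^sup>2) =
          (\<tau> * cnj \<tau>) / of_real (a\<^sup>2) *
          (dilated_conv (chirp M f) v a b * cnj (dilated_conv (chirp M g) v a b))"
        unfolding W by simp
      also have "(\<tau> * cnj \<tau>) / of_real (a\<^sup>2) = of_real (1 / (2 * pi * \<bar>B\<bar>)) * (1 / of_real (a ^ 3))"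
        unfolding \<tau> using True by (simp add: power2_eq_square power3_eq_cube)
      also have "\<dots> * (dilated_conv (chirp M f) v a b * cnj (dilated_conv (chirp M g) v a b)) =
          of_real (1 / (2 * pi * \<bar>B\<bar>)) * (X f z * cnj (X g z))"
        unfolding X root[symmetric] by simp
      finally show ?thesis
        using True by (simp add: Pair)
    next
      case False
      then show ?thesis by (simp add: Pair X_def wavelet_coeff_def)
    qed
  qed
  have inner: "(\<integral>t. chirp M f t * cnj (chirp M g t) \<partial>lborel) = L2_inner f g"
    by (simp add: L2_inner_def chirp_isometry)
  show ?thesis
    unfolding set_integrable_def set_lebesgue_integral_def factor
    using int assms(2) by (simp add: val inner E_def)
qed

end
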